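(* Let $\alpha>0$ and $\varepsilon\ge 0$. The functional $\mathscr H_\varepsilon$ attains a minimum on $N_\alpha$ if one of the following conditions holds: (i) $\alpha>\frac14$ and $0\le\varepsilon<\frac1\alpha$; (ii) $\alpha>0$ and $$0\le \varepsilon\le \frac{1-\tanh\bigl(\frac{1}{2\alpha}\bigr)}{\sqrt{1+\alpha^2}+\frac{\alpha}{4}+\frac{\alpha^2}{4}\sinh\bigl(\frac1\alpha\bigr)-\frac14}.$$
   Context: For $\alpha>0$ let $N_\alpha:=\{u\in H^2(-1,1): u \text{ even},\ u>0 \text{ on } [-1,1],\ u(\pm1)=\alpha,\ u'(\pm1)=0\}$. For positive $u\in H^2(-1,1)$ define the area functional $\mathscr A(u):=2\pi\int_{-1}^1 u\sqrt{1+u'^2}\,dx$, the Willmore functional $$\mathscr W(u):=\frac{\pi}{2}\int_{-1}^1\Bigl(\frac{1}{u\sqrt{1+u'^2}}-\frac{u''}{(1+u'^2)^{3/2}}\Bigr)^2 u\sqrt{1+u'^2}\,dx,$$ and for $\varepsilon\ge0$ the Helfrich functional $\mathscr H_\varepsilon(u):=\mathscr W(u)+\varepsilon\mathscr A(u)$ (these are the Willmore energy and area of the surface of revolution obtained by rotating the graph of $u$ about the $x$-axis). *)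

theory Defs
  imports "HOL-Analysis.Analysis"
begin

text \<open>Sobolev space H^2(-1,1) in one dimension: a function u lies in H^2(-1,1) iff
  (its continuous representative) is differentiable on [-1,1] with derivative u1,
  u1 is absolutely continuous, and u1 is the integral of some u2 in L^2(-1,1).
  We record the first derivative u1 and a (weak, a.e.-determined) second
  derivative u2 explicitly.\<close>

definition H2_triple :: "(real \<Rightarrow> real) \<Rightarrow> (real \<Rightarrow> real) \<Rightarrow> (real \<Rightarrow> real) \<Rightarrow> bool" where
  "H2_triple u u1 u2 \<longleftrightarrow>
     (\<forall>x\<in>{-1..1}. (u has_real_derivative u1 x) (at x within {-1..1})) \<and>
     set_integrable lborel {-1..1::real} u2 \<and>
     set_integrable lborel {-1..1::real} (\<lambda>x. (u2 x)\<^sup>2) \<and>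
     (\<forall>x\<in>{-1..1}. u1 x = u1 (-1) + (\<integral>t\<in>{-1..x}. u2 t \<partial>lborel))"

definition N_alpha :: "real \<Rightarrow> (real \<Rightarrow> real) \<Rightarrow> (real \<Rightarrow> real) \<Rightarrow> (real \<Rightarrow> real) \<Rightarrow> bool" where
  "N_alpha \<alpha> u u1 u2 \<longleftrightarrow>
     H2_triple u u1 u2 \<and>
     (\<forall>x\<in>{-1..1}. u (-x) = u x) \<and>
     (\<forall>x\<in>{-1..1}. u x > 0) \<and>
     u 1 = \<alpha> \<and> u (-1) = \<alpha> \<and> u1 1 = 0 \<and> u1 (-1) = 0"

definition area_fun :: "(real \<Rightarrow> real) \<Rightarrow> (real \<Rightarrow> real) \<Rightarrow> real" where
  "area_fun u u1 = 2 * pi * (\<integral>x\<in>{-1..1}. u x * sqrt (1 + (u1 x)\<^sup>2) \<partial>lborel)"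

definition willmore_fun :: "(real \<Rightarrow> real) \<Rightarrow> (real \<Rightarrow> real) \<Rightarrow> (real \<Rightarrow> real) \<Rightarrow> real" where
  "willmore_fun u u1 u2 = pi / 2 *
     (\<integral>x\<in>{-1..1}. (1 / (u x * sqrt (1 + (u1 x)\<^sup>2)) - u2 x / (sqrt (1 + (u1 x)\<^sup>2)) ^ 3)\<^sup>2
                    * u x * sqrt (1 + (u1 x)\<^sup>2) \<partial>lborel)"

definition helfrich_fun :: "real \<Rightarrow> (real \<Rightarrow> real) \<Rightarrow> (real \<Rightarrow> real) \<Rightarrow> (real \<Rightarrow> real) \<Rightarrow> real" where
  "helfrich_fun \<epsilon> u u1 u2 = willmore_fun u u1 u2 + \<epsilon> * area_fun u u1"

end

theory Submission
  imports Defs "HOL-Complex_Analysis.Great_Picard"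
begin

text \<open>Expanding the square in the Willmore energy, the mixed term integrates to zero because of the
  boundary condition \<open>u' = 0\<close>. Completing two squares in what remains gives
  \<open>\<H>\<^sub>\<epsilon>(u) \<ge> 4\<pi>(s + \<epsilon>) / \<surd>(1 + \<epsilon>)\<close>, where \<open>s\<close> is the maximum of
  \<open>|u'| / \<surd>(1 + u'\<^sup>2)\<close>: since \<open>u'\<close> vanishes at \<open>-1\<close>, \<open>0\<close> and \<open>1\<close>, the total variation of
  \<open>u' / \<surd>(1 + u'\<^sup>2)\<close> is at least \<open>4s\<close>. So as soon as some competitor has energy below
  \<open>4\<pi>\<surd>(1 + \<epsilon>)\<close>, a minimising sequence has bounded slopes; the logarithm of \<open>u\<close> is then bounded,
  the second derivatives are bounded in \<open>L\<^sup>2\<close>, and the direct method applies.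

  For \<open>\<alpha> > 1/4\<close> the competitor is the cylinder: \<open>1/\<alpha> + 4\<epsilon>\<alpha> < 4\<surd>(1 + \<epsilon>)\<close> amounts to
  \<open>|1/\<alpha> - 4\<epsilon>\<alpha>| < 4\<close>. For \<open>\<alpha> \<le> 1/4\<close> it is an arc of a circle centred at the origin, continued in a
  \<open>C\<^sup>1\<close> way by two catenaries; its Willmore energy is \<open>4\<pi> tanh t\<close> with \<open>2t + sinh 2t = 2/\<alpha>\<close>.\<close>

subsection \<open>Weak limits in L2\<close>

text \<open>The obstacle is that nothing in the energy directly forbids vertical tangents: with J =
  sqrt (1 + u'^2), the weight u / J^5 in front of u''^2 degenerates as slopes grow or heights
  shrink. The threshold 4 pi sqrt (1 + \<epsilon>) is the slope estimate evaluated at s = 1, hence a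
  lower bound for the cost of a vertical tangent; staying strictly below it keeps s away from 1. In
  the limit, slopes and heights converge uniformly, so the weight can be frozen and only the weak
  lower semicontinuity of one fixed weighted L2 norm remains. In the competitor for \<alpha> \<le>
  1/4 the catenaries generate surfaces of mean curvature 0 and the arc a piece of a sphere, which
  makes the energy explicit. The fraction in the second hypothesis makes tanh t plus \<epsilon>
  times the rescaled area at most 1; strictness comes from 1 < sqrt (1 + \<epsilon>), or from tanh t
  < 1 when \<epsilon> = 0.\<close>

lemma integral_le_of_tendsto_AE:
  fixes f :: "nat \<Rightarrow> 'a \<Rightarrow> real"
  assumes int: "\<And>i. integrable M (f i)" and nonneg: "\<And>i x. 0 \<le> f i x"
    and g: "g \<in> borel_measurable M" and lim: "AE x in M. (\<lambda>i. f i x) \<longlonglongrightarrow> g x"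
    and bound: "\<And>i. (\<integral>x. f i x \<partial>M) \<le> c"
  shows "integrable M g" and "(\<integral>x. g x \<partial>M) \<le> c"
proof -
  have c: "0 \<le> c"
    using bound[of 0] Bochner_Integration.integral_nonneg[of M "f 0"] nonneg by (metis order_trans)
  have g0: "AE x in M. 0 \<le> g x"
    using lim by eventually_elim (auto intro: LIMSEQ_le_const nonneg)
  have "(\<integral>\<^sup>+x. ennreal (g x) \<partial>M) = (\<integral>\<^sup>+x. liminf (\<lambda>i. ennreal (f i x)) \<partial>M)"
  proof (rule nn_integral_cong_AE, use lim in eventually_elim)
    fix x assume "(\<lambda>i. f i x) \<longlonglongrightarrow> g x"
    then have "(\<lambda>i. ennreal (f i x)) \<longlonglongrightarrow> ennreal (g x)"
      by (rule tendsto_ennrealI)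
    then show "ennreal (g x) = liminf (\<lambda>i. ennreal (f i x))"
      by (metis lim_imp_Liminf trivial_limit_sequentially)
  qed
  also have "\<dots> \<le> liminf (\<lambda>i. \<integral>\<^sup>+x. ennreal (f i x) \<partial>M)"
    using int by (intro nn_integral_liminf) auto
  also have "\<dots> = liminf (\<lambda>i. ennreal (\<integral>x. f i x \<partial>M))"
    using int nonneg by (simp add: nn_integral_eq_integral)
  also have "\<dots> \<le> liminf (\<lambda>i. ennreal c)"
    using bound by (intro Liminf_mono always_eventually allI ennreal_leI) auto
  also have "\<dots> = ennreal c"
    by (simp add: Liminf_const)
  finally have le: "(\<integral>\<^sup>+x. ennreal (g x) \<partial>M) \<le> ennreal c" .
  show int_g: "integrable M g"
    using le g g0 by (intro integrableI_nonneg) (auto simp: le_less_trans)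
  show "(\<integral>x. g x \<partial>M) \<le> c"
    using le c nn_integral_eq_integral[OF int_g g0] by simp
qed

text \<open>Young's inequality with a free weight stands in for Cauchy-Schwarz: integrated over a
  finite measure it bounds an L1 norm by a squared L2 norm, and the weight is fixed only where it is
  used.\<close>

lemma two_abs_le_weighted_square:
  fixes x e :: real
  assumes "0 < e"
  shows "2 * \<bar>x\<bar> \<le> e + x\<^sup>2 / e"
proof -
  have "0 \<le> (\<bar>x\<bar> - e)\<^sup>2" by simp
  then have "2 * \<bar>x\<bar> * e \<le> e * e + x\<^sup>2"
    by (simp add: power2_eq_square algebra_simps)
  then show ?thesis
    using assms by (simp add: field_simps)
qed

lemma (in finite_measure) integrable_of_square:
  fixes f :: "'a \<Rightarrow> real"
  assumes "f \<in> borel_measurable M" "integrable M (\<lambda>x. (f x)\<^sup>2)"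
  shows "integrable M f"
proof (rule Bochner_Integration.integrable_bound)
  show "integrable M (\<lambda>x. 1 + (f x)\<^sup>2)"
    using assms by simp
  show "AE x in M. norm (f x) \<le> norm (1 + (f x)\<^sup>2)"
    using two_abs_le_weighted_square[of 1] by (intro AE_I2) (smt (verit) real_norm_def zero_le_power2 div_by_1)
qed (fact assms)

lemma integrable_mult_of_squares:
  fixes f g :: "'a \<Rightarrow> real"
  assumes "f \<in> borel_measurable M" "integrable M (\<lambda>x. (f x)\<^sup>2)"
    and "g \<in> borel_measurable M" "integrable M (\<lambda>x. (g x)\<^sup>2)"
  shows "integrable M (\<lambda>x. f x * g x)"
proof (rule Bochner_Integration.integrable_bound)
  show "integrable M (\<lambda>x. (f x)\<^sup>2 + (g x)\<^sup>2)"
    using assms by simp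
  show "AE x in M. norm (f x * g x) \<le> norm ((f x)\<^sup>2 + (g x)\<^sup>2)"
  proof (intro AE_I2)
    fix x
    have "2 * (\<bar>f x\<bar> * \<bar>g x\<bar>) \<le> (f x)\<^sup>2 + (g x)\<^sup>2"
      using sum_squares_bound[of "\<bar>f x\<bar>" "\<bar>g x\<bar>"] by simp
    moreover have "0 \<le> \<bar>f x\<bar> * \<bar>g x\<bar>" by simp
    ultimately show "norm (f x * g x) \<le> norm ((f x)\<^sup>2 + (g x)\<^sup>2)"
      by (simp only: real_norm_def abs_mult)
  qed
qed (use assms in simp)

lemma (in finite_measure) integral_abs_le_weighted_square:
  fixes f :: "'a \<Rightarrow> real"
  assumes "f \<in> borel_measurable M" "integrable M (\<lambda>x. (f x)\<^sup>2)" "0 < e"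
  shows "2 * (\<integral>x. \<bar>f x\<bar> \<partial>M) \<le> e * measure M (space M) + (\<integral>x. (f x)\<^sup>2 \<partial>M) / e"
proof -
  have "(\<integral>x. 2 * \<bar>f x\<bar> \<partial>M) \<le> (\<integral>x. e + (f x)\<^sup>2 / e \<partial>M)"
    using assms integrable_of_square[OF assms(1,2)] two_abs_le_weighted_square[OF assms(3)]
    by (intro integral_mono) auto
  then show ?thesis
    using assms by (simp add: mult.commute)
qed

text \<open>Averages of two functions are the only convex combinations that the parallelogram law
  needs. Restricting to them gives plain structural induction, with no finite weighted sums.\<close>

inductive_set midpoint_hull :: "(nat \<Rightarrow> 'a \<Rightarrow> real) \<Rightarrow> nat \<Rightarrow> ('a \<Rightarrow> real) set"
  for h n where
  member: "n \<le> k \<Longrightarrow> h k \<in> midpoint_hull h n"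
| midpoint: "f \<in> midpoint_hull h n \<Longrightarrow> g \<in> midpoint_hull h n \<Longrightarrow>
    (\<lambda>x. (f x + g x) / 2) \<in> midpoint_hull h n"

lemma midpoint_hull_antimono:
  assumes "f \<in> midpoint_hull h m" "n \<le> m"
  shows "f \<in> midpoint_hull h n"
  using assms by (induction rule: midpoint_hull.induct) (auto intro: midpoint_hull.intros)

lemma midpoint_hull_square_integrable:
  assumes "f \<in> midpoint_hull h n"
    and h: "\<And>k. h k \<in> borel_measurable M" "\<And>k. integrable M (\<lambda>x. (h k x)\<^sup>2)"
  shows "f \<in> borel_measurable M \<and> integrable M (\<lambda>x. (f x)\<^sup>2)"
  using assms(1)
proof (induction rule: midpoint_hull.induct)
  case (midpoint f g)
  then have "integrable M (\<lambda>x. f x * g x)"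
    by (intro integrable_mult_of_squares) auto
  then have "integrable M (\<lambda>x. ((f x)\<^sup>2 + 2 * (f x * g x) + (g x)\<^sup>2) / 4)"
    using midpoint by auto
  moreover have "((f x)\<^sup>2 + 2 * (f x * g x) + (g x)\<^sup>2) / 4 = ((f x + g x) / 2)\<^sup>2" for x
    by (simp add: power2_eq_square field_simps)
  ultimately show ?case
    using midpoint by auto
qed (use h in auto)

text \<open>The interval of radius \<open>e\<close> around \<open>L\<close> is convex, hence stable
  under averaging; so convergence of the tested integrals along \<open>h\<close> is inherited by any
  choice of elements from the tail hulls.\<close>

lemma (in finite_measure) midpoint_hull_integral_close:
  assumes "f \<in> midpoint_hull h n"
    and h: "\<And>k. h k \<in> borel_measurable M" "\<And>k. integrable M (\<lambda>x. (h k x)\<^sup>2)"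
    and int: "\<And>k. integrable M (\<lambda>x. h k x * \<phi> x)"
    and close: "\<And>k. n \<le> k \<Longrightarrow> \<bar>(\<integral>x. h k x * \<phi> x \<partial>M) - L\<bar> \<le> e"
  shows "integrable M (\<lambda>x. f x * \<phi> x) \<and> \<bar>(\<integral>x. f x * \<phi> x \<partial>M) - L\<bar> \<le> e"
  using assms(1)
proof (induction rule: midpoint_hull.induct)
  case (midpoint f g)
  have mean: "\<bar>(a + b) / 2 - L\<bar> \<le> e" if "\<bar>a - L\<bar> \<le> e" "\<bar>b - L\<bar> \<le> e" for a b
    using that by (simp add: abs_le_iff field_simps)
  have "(\<lambda>x. (f x + g x) / 2 * \<phi> x) = (\<lambda>x. (f x * \<phi> x + g x * \<phi> x) / 2)"
    by (auto simp: field_simps)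
  then show ?case
    using midpoint mean by simp
qed (use int close in auto)

text \<open>Banach--Saks without Riesz: almost norm-minimal elements of the midpoint hulls of the tails
  form a Cauchy sequence by the parallelogram law, and testing against a fixed function
  passes to the hulls.\<close>

lemma (in finite_measure) L2_weak_limit:
  fixes h :: "nat \<Rightarrow> 'a \<Rightarrow> real"
  assumes meas: "\<And>k. h k \<in> borel_measurable M"
    and sq: "\<And>k. integrable M (\<lambda>x. (h k x)\<^sup>2)"
    and lim: "(\<lambda>k. \<integral>x. (h k x)\<^sup>2 \<partial>M) \<longlonglongrightarrow> C"
  obtains g where "g \<in> borel_measurable M" "integrable M (\<lambda>x. (g x)\<^sup>2)" "(\<integral>x. (g x)\<^sup>2 \<partial>M) \<le> C"
    "\<And>\<phi> B L. \<phi> \<in> borel_measurable M \<Longrightarrow> (\<And>x. \<bar>\<phi> x\<bar> \<le> B) \<Longrightarrow>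
       (\<lambda>k. \<integral>x. h k x * \<phi> x \<partial>M) \<longlonglongrightarrow> L \<Longrightarrow> (\<integral>x. g x * \<phi> x \<partial>M) = L"
proof -
  let ?S = "midpoint_hull h"
  define I where "I f = (\<integral>x. (f x)\<^sup>2 \<partial>M)" for f :: "'a \<Rightarrow> real"
  have S: "f \<in> borel_measurable M" "integrable M (\<lambda>x. (f x)\<^sup>2)" if "f \<in> ?S n" for f n
    using midpoint_hull_square_integrable[OF that meas sq] by auto
  have I0: "0 \<le> I f" for f
    by (simp add: I_def)
  \<comment> \<open>\<open>d n\<close> is the infimum of the squared norm over the tail hull. The
    hulls shrink with n, so \<open>d\<close> increases; it is bounded through the members
    \<open>h k\<close>, and its limit is at most \<open>C\<close>.\<close>
  define d where "d n = Inf (I ` ?S n)" for n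
  have bdd: "bdd_below (I ` ?S n)" for n
    using I0 by (auto intro!: bdd_belowI[of _ 0])
  have ne: "I ` ?S n \<noteq> {}" for n
    using midpoint_hull.member[of n n h] by auto
  have d_le: "d n \<le> I f" if "f \<in> ?S n" for f n
    unfolding d_def using that bdd by (intro cInf_lower) auto
  have "incseq d"
    unfolding d_def incseq_def
    by (intro allI impI cInf_superset_mono ne bdd image_mono) (auto intro: midpoint_hull_antimono)
  have limI: "(\<lambda>k. I (h k)) \<longlonglongrightarrow> C"
    using lim by (simp add: I_def)
  obtain K where K: "\<And>k. I (h k) \<le> K"
    using limI by (metis Bseq_def BseqE convergent_def convergent_imp_Bseq real_norm_def abs_le_D1)
  have "d n \<le> K" for n
    using d_le[OF midpoint_hull.member[OF order.refl]] K by (rule order_trans)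
  then obtain D where D: "d \<longlonglongrightarrow> D"
    using incseq_convergent[OF \<open>incseq d\<close>] by metis
  have "D \<le> C"
    using D limI by (rule LIMSEQ_le) (auto intro: d_le midpoint_hull.member)
  have "\<exists>f\<in>?S n. I f < d n + 1 / Suc n" for n
    using cInf_lessD[OF ne, of n "d n + 1 / Suc n"] by (auto simp: d_def)
  then obtain w where w: "\<And>n. w n \<in> ?S n" "\<And>n. I (w n) < d n + 1 / Suc n"
    by metis
  have limw: "(\<lambda>n. I (w n)) \<longlonglongrightarrow> D"
  proof (rule tendsto_sandwich[of d _ _ "\<lambda>n. d n + 1 / Suc n"])
    show "(\<lambda>n. d n + 1 / Suc n) \<longlonglongrightarrow> D"
      using tendsto_add[OF D LIMSEQ_inverse_real_of_nat] by (simp add: divide_inverse)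
  qed (use w d_le D in \<open>auto intro: always_eventually less_imp_le\<close>)
  have wS: "w m \<in> ?S n" if "n \<le> m" for m n
    using midpoint_hull_antimono[OF w(1) that] .
  have diff_sq: "integrable M (\<lambda>x. (w n x - w m x)\<^sup>2)" for m n
  proof -
    have "integrable M (\<lambda>x. (w n x)\<^sup>2 + (w m x)\<^sup>2 - 2 * (w n x * w m x))"
      using S[OF w(1)] by (intro Bochner_Integration.integrable_diff Bochner_Integration.integrable_add
          integrable_mult_right integrable_mult_of_squares) auto
    then show ?thesis by (simp add: power2_diff mult.assoc)
  qed
  have par: "I (\<lambda>x. w n x - w m x) \<le> 2 * I (w n) + 2 * I (w m) - 4 * d n" if "n \<le> m" for n m
  proof -
    \<comment> \<open>The average stays in the tail hull \<open>n\<close>, so its squared norm is at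
      least \<open>d n\<close>; by the parallelogram law two almost minimal elements are then
      close.\<close>
    let ?v = "\<lambda>x. (w n x + w m x) / 2"
    have v: "?v \<in> ?S n"
      using wS[OF that] w(1) by (rule midpoint_hull.midpoint[rotated])
    have "I (\<lambda>x. w n x - w m x) = (\<integral>x. 2 * (w n x)\<^sup>2 + 2 * (w m x)\<^sup>2 - 4 * (?v x)\<^sup>2 \<partial>M)"
      unfolding I_def by (intro Bochner_Integration.integral_cong) (auto simp: power2_eq_square field_simps)
    also have "\<dots> = 2 * I (w n) + 2 * I (w m) - 4 * I ?v"
      unfolding I_def using S[OF w(1)] S[OF v]
      by (subst Bochner_Integration.integral_diff Bochner_Integration.integral_add;
          (intro Bochner_Integration.integrable_add integrable_mult_right)?; simp)+
    finally show ?thesis using d_le[OF v] by simp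
  qed
  have cauchy2: "\<exists>N. \<forall>i\<ge>N. \<forall>j\<ge>N. I (\<lambda>x. w i x - w j x) < e" if "0 < e" for e
  proof -
    have "eventually (\<lambda>n. I (w n) < D + e / 8) sequentially" "eventually (\<lambda>n. D - e / 8 < d n) sequentially"
      using limw D that by (auto intro!: order_tendstoD)
    then obtain N where N: "\<And>n. n \<ge> N \<Longrightarrow> I (w n) < D + e / 8 \<and> D - e / 8 < d n"
      unfolding eventually_sequentially by (metis le_trans nat_le_linear)
    have "I (\<lambda>x. w i x - w j x) < e" if "N \<le> i" "N \<le> j" for i j
    proof (cases "i \<le> j")
      case True
      then show ?thesis using par[of i j] N[of i] N[of j] that by simp
    next
      case False
      then have "I (\<lambda>x. w j x - w i x) < e"
        using par[of j i] N[of i] N[of j] that by simp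
      then show ?thesis by (simp add: I_def power2_commute)
    qed
    then show ?thesis by blast
  qed
  have cauchy1: "\<exists>N. \<forall>i\<ge>N. \<forall>j\<ge>N. (\<integral>x. \<bar>w i x - w j x\<bar> \<partial>M) < e" if "0 < e" for e
  proof -
    \<comment> \<open>Young's inequality with weight \<open>\<eta>\<close> turns L2 closeness into
      L1 closeness: neither term on its right-hand side exceeds e. The summand 1 covers a space of
      measure 0.\<close>
    define \<eta> where "\<eta> = e / (measure M (space M) + 1)"
    have m: "0 < measure M (space M) + 1"
      using measure_nonneg[of M "space M"] by linarith
    then have \<eta>: "0 < \<eta>" using that by (simp add: \<eta>_def)
    obtain N where N: "\<And>i j. N \<le> i \<Longrightarrow> N \<le> j \<Longrightarrow> I (\<lambda>x. w i x - w j x) < \<eta> * e"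
      using cauchy2[of "\<eta> * e"] \<eta> \<open>0 < e\<close> by auto
    have "(\<integral>x. \<bar>w i x - w j x\<bar> \<partial>M) < e" if "N \<le> i" "N \<le> j" for i j
    proof -
      have "2 * (\<integral>x. \<bar>w i x - w j x\<bar> \<partial>M)
          \<le> \<eta> * measure M (space M) + I (\<lambda>x. w i x - w j x) / \<eta>"
        unfolding I_def using S(1)[OF w(1)] diff_sq \<eta>
        by (intro integral_abs_le_weighted_square) auto
      moreover have "\<eta> * measure M (space M) \<le> e"
        unfolding \<eta>_def using \<open>0 < e\<close> m by (simp add: field_simps)
      moreover have "I (\<lambda>x. w i x - w j x) / \<eta> < e"
        using N[OF that] \<eta> by (simp add: field_simps)
      ultimately show ?thesis by simp
    qed
    then show ?thesis by blast
  qed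
  have int_w: "integrable M (w n)" for n
    using S[OF w(1)] by (rule integrable_of_square)
  have cauchy_norm: "\<exists>N. \<forall>i\<ge>N. \<forall>j\<ge>N. (\<integral>x. norm (w i x - w j x) \<partial>M) < e" if "0 < e" for e
    unfolding real_norm_def using that by (rule cauchy1)
  \<comment> \<open>L1 closeness supplies an almost everywhere Cauchy subsequence; its pointwise
    limit is the candidate, and Fatou bounds its square.\<close>
  obtain r where r: "strict_mono r" "AE x in M. Cauchy (\<lambda>i. w (r i) x)"
    by (rule cauchy_L1_AE_cauchy_subseq[OF int_w cauchy_norm])
  define g where "g x = lim (\<lambda>i. w (r i) x)" for x
  have g_meas: "g \<in> borel_measurable M"
    unfolding g_def using S(1)[OF w(1)] by (intro borel_measurable_lim_metric) auto
  have g_lim: "AE x in M. (\<lambda>i. w (r i) x) \<longlonglongrightarrow> g x"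
    using r(2) by eventually_elim (simp add: g_def convergent_LIMSEQ_iff[symmetric] Cauchy_convergent)
  have r_ge: "i \<le> r i" for i
    using r(1) by (rule seq_suble)
  have g_sq_le: "integrable M (\<lambda>x. (g x)\<^sup>2) \<and> (\<integral>x. (g x)\<^sup>2 \<partial>M) \<le> D + e" if "0 < e" for e
  proof -
    have "eventually (\<lambda>n. I (w n) < D + e) sequentially"
      using limw that by (auto intro!: order_tendstoD)
    then obtain N where N: "\<And>n. N \<le> n \<Longrightarrow> I (w n) < D + e"
      unfolding eventually_sequentially by auto
    \<comment> \<open>The shift by \<open>N\<close> makes the norm bound hold at every index, as the
      Fatou argument requires.\<close>
    have "AE x in M. (\<lambda>i. (w (r (i + N)) x)\<^sup>2) \<longlonglongrightarrow> (g x)\<^sup>2"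
      using g_lim by eventually_elim (intro tendsto_power LIMSEQ_ignore_initial_segment)
    moreover have "I (w (r (i + N))) \<le> D + e" for i
      using N[of "r (i + N)"] r_ge[of "i + N"] by simp
    ultimately show ?thesis
      using integral_le_of_tendsto_AE[of M "\<lambda>i x. (w (r (i + N)) x)\<^sup>2" "\<lambda>x. (g x)\<^sup>2" "D + e"]
        S[OF w(1)] g_meas by (auto simp: I_def)
  qed
  have g_int: "integrable M g"
    using g_sq_le[of 1] by (simp add: integrable_of_square[OF g_meas])
  have g_close: "\<exists>N. \<forall>n\<ge>N. (\<integral>x. \<bar>g x - w n x\<bar> \<partial>M) \<le> e" if "0 < e" for e
  proof -
    obtain N where N: "\<And>i j. N \<le> i \<Longrightarrow> N \<le> j \<Longrightarrow> (\<integral>x. \<bar>w i x - w j x\<bar> \<partial>M) < e"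
      using cauchy1[OF \<open>0 < e\<close>] by auto
    have "(\<integral>x. \<bar>g x - w n x\<bar> \<partial>M) \<le> e" if "N \<le> n" for n
    proof (rule integral_le_of_tendsto_AE(2))
      show "AE x in M. (\<lambda>i. \<bar>w (r (i + N)) x - w n x\<bar>) \<longlonglongrightarrow> \<bar>g x - w n x\<bar>"
        using g_lim by eventually_elim
          (intro tendsto_rabs tendsto_diff tendsto_const LIMSEQ_ignore_initial_segment)
      show "(\<integral>x. \<bar>w (r (i + N)) x - w n x\<bar> \<partial>M) \<le> e" for i
        using N[of "r (i + N)" n] r_ge[of "i + N"] that by simp
    qed (use int_w g_meas S(1)[OF w(1)] in auto)
    then show ?thesis by blast
  qed
  show thesis
  proof (rule that[of g])
    show "(\<integral>x. (g x)\<^sup>2 \<partial>M) \<le> C"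
    proof (rule field_le_epsilon)
      fix e :: real assume "0 < e"
      then show "(\<integral>x. (g x)\<^sup>2 \<partial>M) \<le> C + e"
        using g_sq_le[of e] \<open>D \<le> C\<close> by linarith
    qed
    fix \<phi> :: "'a \<Rightarrow> real" and B L
    assume \<phi>: "\<phi> \<in> borel_measurable M" and B: "\<And>x. \<bar>\<phi> x\<bar> \<le> B"
      and L: "(\<lambda>k. \<integral>x. h k x * \<phi> x \<partial>M) \<longlonglongrightarrow> L"
    have B0: "0 \<le> B" using B[of undefined] by simp
    have int_\<phi>: "integrable M (\<lambda>x. f x * \<phi> x)" if "integrable M f" for f
    proof (rule Bochner_Integration.integrable_bound)
      show "integrable M (\<lambda>x. B * f x)" using that by simp
      show "AE x in M. norm (f x * \<phi> x) \<le> norm (B * f x)"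
        using B B0 by (intro AE_I2) (simp add: abs_mult mult.commute mult_right_mono)
    qed (use that \<phi> in auto)
    have "\<bar>(\<integral>x. g x * \<phi> x \<partial>M) - L\<bar> \<le> e" if "0 < e" for e
    proof -
      obtain N1 where N1: "\<And>k. N1 \<le> k \<Longrightarrow> \<bar>(\<integral>x. h k x * \<phi> x \<partial>M) - L\<bar> \<le> e / 2"
        using L \<open>0 < e\<close> unfolding LIMSEQ_iff by (metis half_gt_zero less_imp_le real_norm_def)
      have "0 < e / (2 * (B + 1))" using B0 \<open>0 < e\<close> by simp
      then obtain N2 where N2: "\<And>n. N2 \<le> n \<Longrightarrow> (\<integral>x. \<bar>g x - w n x\<bar> \<partial>M) \<le> e / (2 * (B + 1))"
        using g_close by blast
      \<comment> \<open>One hull element serves both errors: \<open>N1\<close> controls its tested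
        integral, \<open>N2\<close> its L1 distance to \<open>g\<close>.\<close>
      define n where "n = max N1 N2"
      have "\<bar>(\<integral>x. w n x * \<phi> x \<partial>M) - L\<bar> \<le> e / 2"
        using midpoint_hull_integral_close[OF w(1) meas sq, of \<phi> n L "e / 2"] N1
          int_\<phi>[OF integrable_of_square[OF meas sq]] by (auto simp: n_def)
      moreover have "\<bar>(\<integral>x. g x * \<phi> x \<partial>M) - (\<integral>x. w n x * \<phi> x \<partial>M)\<bar> \<le> e / 2"
      proof -
        have "\<bar>(\<integral>x. g x * \<phi> x \<partial>M) - (\<integral>x. w n x * \<phi> x \<partial>M)\<bar> = \<bar>\<integral>x. (g x - w n x) * \<phi> x \<partial>M\<bar>"
          using int_\<phi>[OF g_int] int_\<phi>[OF int_w] by (simp add: left_diff_distrib)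
        also have "\<dots> \<le> (\<integral>x. \<bar>(g x - w n x) * \<phi> x\<bar> \<partial>M)"
          by (rule integral_abs_bound)
        also have "\<dots> \<le> (\<integral>x. B * \<bar>g x - w n x\<bar> \<partial>M)"
        proof (rule integral_mono)
          show "integrable M (\<lambda>x. \<bar>(g x - w n x) * \<phi> x\<bar>)"
            using g_int int_w by (intro integrable_abs int_\<phi>) auto
          show "\<bar>(g x - w n x) * \<phi> x\<bar> \<le> B * \<bar>g x - w n x\<bar>" for x
            using B by (simp add: abs_mult mult.commute mult_right_mono)
        qed (use g_int int_w in auto)
        also have "\<dots> = B * (\<integral>x. \<bar>g x - w n x\<bar> \<partial>M)" by simp
        also have "\<dots> \<le> B * (e / (2 * (B + 1)))"
          using B0 N2[of n] by (intro mult_left_mono) (auto simp: n_def)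
        also have "\<dots> \<le> e / 2"
          using B0 \<open>0 < e\<close> by (simp add: field_simps)
        finally show ?thesis .
      qed
      ultimately show ?thesis by linarith
    qed
    then show "(\<integral>x. g x * \<phi> x \<partial>M) = L"
      using dense_eq0_I[of "(\<integral>x. g x * \<phi> x \<partial>M) - L"] by simp
  qed (use g_meas g_sq_le[of 1] in auto)
qed

subsection \<open>Absolutely continuous functions\<close>

lemma set_integral_combine:
  fixes f :: "real \<Rightarrow> real"
  assumes "set_integrable lborel {a..b} f" "a \<le> c" "c \<le> b"
  shows "(\<integral>t\<in>{a..b}. f t \<partial>lborel) = (\<integral>t\<in>{a..c}. f t \<partial>lborel) + (\<integral>t\<in>{c..b}. f t \<partial>lborel)"
proof -
  have "set_integrable lborel {a..c} f" "set_integrable lborel {c..b} f"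
    using assms by (auto intro: set_integrable_subset)
  then show ?thesis
    using assms Henstock_Kurzweil_Integration.integral_combine[of a c b f]
    by (simp add: set_borel_integral_eq_integral)
qed

lemma set_integrable_continuous_mult:
  fixes c g :: "real \<Rightarrow> real"
  assumes g: "set_integrable lborel {a..b} g" and c: "continuous_on {a..b} c"
  shows "set_integrable lborel {a..b} (\<lambda>t. c t * g t)"
proof -
  have "compact (c ` {a..b})"
    using c by (intro compact_continuous_image) auto
  then have "\<exists>B. \<forall>t\<in>{a..b}. \<bar>c t\<bar> \<le> B"
    by (auto dest!: compact_imp_bounded simp: bounded_iff)
  then obtain B where B: "\<And>t. t \<in> {a..b} \<Longrightarrow> \<bar>c t\<bar> \<le> B"
    by blast
  have cm: "(\<lambda>t. indicator {a..b} t *\<^sub>R c t) \<in> borel_measurable lborel"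
    using set_measurable_continuous_on[of "{a..b}" c] c by (simp add: set_borel_measurable_def)
  have gi: "integrable lborel (\<lambda>t. indicator {a..b} t *\<^sub>R g t)"
    using g by (simp add: set_integrable_def)
  have gm: "(\<lambda>t. indicator {a..b} t *\<^sub>R g t) \<in> borel_measurable lborel"
    using gi by (rule borel_measurable_integrable)
  have eq: "indicator {a..b} t *\<^sub>R (c t * g t) = (indicator {a..b} t *\<^sub>R c t) * (indicator {a..b} t *\<^sub>R g t)" for t
    by (simp add: indicator_def)
  show ?thesis
    unfolding set_integrable_def eq
  proof (rule Bochner_Integration.integrable_bound)
    show "integrable lborel (\<lambda>t. B * (indicator {a..b} t *\<^sub>R g t))"
      using gi by (intro integrable_mult_right) auto
    show "AE t in lborel. norm (indicator {a..b} t *\<^sub>R c t * (indicator {a..b} t *\<^sub>R g t))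
        \<le> norm (B * (indicator {a..b} t *\<^sub>R g t))"
    proof (intro AE_I2)
      fix t
      show "norm (indicator {a..b} t *\<^sub>R c t * (indicator {a..b} t *\<^sub>R g t))
        \<le> norm (B * (indicator {a..b} t *\<^sub>R g t))"
        using B[of t] by (cases "t \<in> {a..b}") (auto simp: abs_mult intro: mult_right_mono)
    qed
    show "(\<lambda>t. indicator {a..b} t *\<^sub>R c t * (indicator {a..b} t *\<^sub>R g t)) \<in> borel_measurable lborel"
      using cm gm by (rule borel_measurable_times)
  qed
qed

lemma set_integrable_continuous_Icc:
  fixes f :: "real \<Rightarrow> real"
  assumes "continuous_on {a..b} f"
  shows "set_integrable lborel {a..b} f"
  using assms by (intro borel_integrable_compact[folded set_integrable_def]) auto

text \<open>The derivative \<open>g\<close> of \<open>f\<close> is given only in the integrated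
  sense, so no pointwise chain rule is available. Instead the defect on a subinterval is shown to be
  at most \<open>e\<close> times the integral of |g|. This estimate survives joining adjacent
  intervals, so Bolzano bisection reduces it to short intervals, where \<open>\<Phi>'\<close> along
  \<open>f\<close> is nearly constant.\<close>

lemma absolutely_continuous_chain_rule:
  fixes f g \<Phi> \<Phi>' :: "real \<Rightarrow> real"
  assumes ab: "a \<le> b" and g: "set_integrable lborel {a..b} g"
    and f: "\<And>x y. a \<le> x \<Longrightarrow> x \<le> y \<Longrightarrow> y \<le> b \<Longrightarrow> f y - f x = (\<integral>t\<in>{x..y}. g t \<partial>lborel)"
    and fc: "continuous_on {a..b} f"
    and \<Phi>: "\<And>z. (\<Phi> has_real_derivative \<Phi>' z) (at z)" and \<Phi>': "continuous_on UNIV \<Phi>'"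
  shows "\<Phi> (f b) - \<Phi> (f a) = (\<integral>t\<in>{a..b}. \<Phi>' (f t) * g t \<partial>lborel)"
proof -
  have cont: "continuous_on {a..b} (\<lambda>t. \<Phi>' (f t))"
    using continuous_on_compose2[OF \<Phi>' fc] by auto
  have int: "set_integrable lborel {a..b} (\<lambda>t. \<Phi>' (f t) * g t)"
    using g cont by (rule set_integrable_continuous_mult)
  have abs: "set_integrable lborel {a..b} (\<lambda>t. \<bar>g t\<bar>)"
    using g by (rule set_integrable_abs)
  have sub: "set_integrable lborel {x..y} h" if "set_integrable lborel {a..b} h" "a \<le> x" "y \<le> b"
    for h :: "real \<Rightarrow> real" and x y
    using that by (auto intro: set_integrable_subset)
  \<comment> \<open>The premise confines the estimate to subintervals of [a, b]; the local step of
    the bisection also produces intervals that stick out.\<close>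
  define P where "P e x y \<longleftrightarrow> (a \<le> x \<and> y \<le> b \<longrightarrow>
    \<bar>\<Phi> (f y) - \<Phi> (f x) - (\<integral>t\<in>{x..y}. \<Phi>' (f t) * g t \<partial>lborel)\<bar> \<le> e * (\<integral>t\<in>{x..y}. \<bar>g t\<bar> \<partial>lborel))"
    for e x y
  have "P e a b" if "0 < e" for e
    using ab
  proof (induction rule: Bolzano)
    case (trans x y z)
    show ?case
      unfolding P_def
    proof (intro impI)
      assume "a \<le> x \<and> z \<le> b"
      then have "(\<integral>t\<in>{x..z}. \<Phi>' (f t) * g t \<partial>lborel) =
          (\<integral>t\<in>{x..y}. \<Phi>' (f t) * g t \<partial>lborel) + (\<integral>t\<in>{y..z}. \<Phi>' (f t) * g t \<partial>lborel)"
        "(\<integral>t\<in>{x..z}. \<bar>g t\<bar> \<partial>lborel) = (\<integral>t\<in>{x..y}. \<bar>g t\<bar> \<partial>lborel) + (\<integral>t\<in>{y..z}. \<bar>g t\<bar> \<partial>lborel)"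
        using trans sub[OF int, of x z] sub[OF abs, of x z] by (auto intro!: set_integral_combine)
      then show "\<bar>\<Phi> (f z) - \<Phi> (f x) - (\<integral>t\<in>{x..z}. \<Phi>' (f t) * g t \<partial>lborel)\<bar>
          \<le> e * (\<integral>t\<in>{x..z}. \<bar>g t\<bar> \<partial>lborel)"
        using trans \<open>a \<le> x \<and> z \<le> b\<close> unfolding P_def by (simp add: distrib_left)
    qed
  next
    case (local x)
    have "isCont \<Phi>' (f x)"
      using \<Phi>' by (simp add: continuous_on_eq_continuous_at)
    then obtain d1 where d1: "0 < d1" "\<And>z. \<bar>z - f x\<bar> < d1 \<Longrightarrow> \<bar>\<Phi>' z - \<Phi>' (f x)\<bar> < e / 2"
      using \<open>0 < e\<close> unfolding continuous_at_eps_delta dist_real_def by (meson half_gt_zero)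
    obtain d2 where d2: "0 < d2" "\<And>t. t \<in> {a..b} \<Longrightarrow> \<bar>t - x\<bar> < d2 \<Longrightarrow> \<bar>f t - f x\<bar> < d1"
      using fc local d1(1) unfolding continuous_on_iff dist_real_def by (meson atLeastAtMost_iff)
    have "P e p q" if pq: "p \<le> x" "x \<le> q" "q - p < d2" for p q
      unfolding P_def
    proof (intro impI)
      assume abpq: "a \<le> p \<and> q \<le> b"
      have near: "\<bar>f t - f x\<bar> < d1" if "t \<in> {p..q}" for t
        using d2(2)[of t] that pq abpq by auto
      \<comment> \<open>The mean value theorem is applied to \<open>\<Phi>\<close> between the
        values \<open>f p\<close> and \<open>f q\<close>, in whichever order they lie, so the
        intermediate value stays within \<open>d1\<close> of \<open>f x\<close>.\<close>
      obtain \<xi> where \<xi>: "\<Phi> (f q) - \<Phi> (f p) = \<Phi>' \<xi> * (f q - f p)" "\<bar>\<xi> - f x\<bar> < d1"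
      proof -
        consider "f p = f q" | "f p < f q" | "f q < f p" by linarith
        then show thesis
        proof cases
          case 1
          then show ?thesis using that[of "f x"] d1(1) by simp
        next
          case 2
          then obtain z where "f p < z" "z < f q" "\<Phi> (f q) - \<Phi> (f p) = (f q - f p) * \<Phi>' z"
            using MVT2[of "f p" "f q" \<Phi> \<Phi>'] \<Phi> by auto
          then show ?thesis
            using that[of z] near[of p] near[of q] pq by (auto simp: mult.commute)
        next
          case 3
          then obtain z where "f q < z" "z < f p" "\<Phi> (f p) - \<Phi> (f q) = (f p - f q) * \<Phi>' z"
            using MVT2[of "f q" "f p" \<Phi> \<Phi>'] \<Phi> by auto
          then show ?thesis
            using that[of z] near[of p] near[of q] pq by (auto simp: algebra_simps)
        qed
      qed
      have int_pq: "set_integrable lborel {p..q} g" "set_integrable lborel {p..q} (\<lambda>t. \<Phi>' (f t) * g t)"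
        "set_integrable lborel {p..q} (\<lambda>t. \<bar>g t\<bar>)"
        using sub g int abs abpq by auto
      have "\<Phi> (f q) - \<Phi> (f p) - (\<integral>t\<in>{p..q}. \<Phi>' (f t) * g t \<partial>lborel)
          = \<Phi>' \<xi> * (\<integral>t\<in>{p..q}. g t \<partial>lborel) - (\<integral>t\<in>{p..q}. \<Phi>' (f t) * g t \<partial>lborel)"
        using \<xi>(1) f[of p q] pq abpq by simp
      also have "\<dots> = (\<integral>t\<in>{p..q}. \<Phi>' \<xi> * g t - \<Phi>' (f t) * g t \<partial>lborel)"
        using int_pq by simp
      finally have eq: "\<Phi> (f q) - \<Phi> (f p) - (\<integral>t\<in>{p..q}. \<Phi>' (f t) * g t \<partial>lborel)
          = (\<integral>t\<in>{p..q}. \<Phi>' \<xi> * g t - \<Phi>' (f t) * g t \<partial>lborel)" .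
      have diff: "set_integrable lborel {p..q} (\<lambda>t. \<Phi>' \<xi> * g t - \<Phi>' (f t) * g t)"
        using int_pq by (intro set_integral_diff) auto
      have bound: "\<bar>\<Phi>' \<xi> * g t - \<Phi>' (f t) * g t\<bar> \<le> e * \<bar>g t\<bar>" if "t \<in> {p..q}" for t
      proof -
        have "\<bar>\<Phi>' \<xi> - \<Phi>' (f t)\<bar> \<le> e"
          using d1(2)[OF \<xi>(2)] d1(2)[OF near[OF that]] by linarith
        then show ?thesis
          by (simp add: abs_mult mult_right_mono flip: left_diff_distrib)
      qed
      have "\<bar>\<integral>t\<in>{p..q}. \<Phi>' \<xi> * g t - \<Phi>' (f t) * g t \<partial>lborel\<bar>
          \<le> (\<integral>t\<in>{p..q}. \<bar>\<Phi>' \<xi> * g t - \<Phi>' (f t) * g t\<bar> \<partial>lborel)"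
        unfolding set_lebesgue_integral_def
        by (rule order_trans[OF integral_abs_bound]) (simp add: abs_mult)
      also have "\<dots> \<le> (\<integral>t\<in>{p..q}. e * \<bar>g t\<bar> \<partial>lborel)"
        using int_pq diff bound by (intro set_integral_mono set_integrable_abs) auto
      finally show "\<bar>\<Phi> (f q) - \<Phi> (f p) - (\<integral>t\<in>{p..q}. \<Phi>' (f t) * g t \<partial>lborel)\<bar>
          \<le> e * (\<integral>t\<in>{p..q}. \<bar>g t\<bar> \<partial>lborel)"
        unfolding eq by simp
    qed
    then show ?case using d2(1) by blast
  qed
  then have le: "\<bar>\<Phi> (f b) - \<Phi> (f a) - (\<integral>t\<in>{a..b}. \<Phi>' (f t) * g t \<partial>lborel)\<bar>
      \<le> e * (\<integral>t\<in>{a..b}. \<bar>g t\<bar> \<partial>lborel)" if "0 < e" for e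
    using that unfolding P_def by auto
  define K where "K = (\<integral>t\<in>{a..b}. \<bar>g t\<bar> \<partial>lborel)"
  have K: "0 \<le> K"
    unfolding K_def set_lebesgue_integral_def by (intro Bochner_Integration.integral_nonneg) auto
  have "\<bar>\<Phi> (f b) - \<Phi> (f a) - (\<integral>t\<in>{a..b}. \<Phi>' (f t) * g t \<partial>lborel)\<bar> \<le> e" if "0 < e" for e
  proof -
    have "e / (K + 1) * K \<le> e"
      using K that by (simp add: field_simps)
    then show ?thesis
      using le[of "e / (K + 1)"] K that unfolding K_def by fastforce
  qed
  then show ?thesis
    using dense_eq0_I[of "\<Phi> (f b) - \<Phi> (f a) - (\<integral>t\<in>{a..b}. \<Phi>' (f t) * g t \<partial>lborel)"] by simp
qed

subsection \<open>Energy identity and slope estimate\<close>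

text \<open>If z is the tangent of the inclination angle, this function is its sine. Hence u'' / J^3
  in the Willmore integrand is an exact derivative, which settles the cross term and links the
  curvature term to a total variation.\<close>

lemma DERIV_sine_of_slope:
  "((\<lambda>z. z / sqrt (1 + z\<^sup>2)) has_real_derivative 1 / sqrt (1 + z\<^sup>2) ^ 3) (at z)"
proof -
  have pos: "0 < 1 + z\<^sup>2"
    by (smt (verit) zero_le_power2)
  have J: "sqrt (1 + z\<^sup>2) * sqrt (1 + z\<^sup>2) = 1 + z\<^sup>2"
    using pos by simp
  have "((\<lambda>z. z / sqrt (1 + z\<^sup>2)) has_real_derivative
      (sqrt (1 + z\<^sup>2) - z * (z / sqrt (1 + z\<^sup>2))) / (sqrt (1 + z\<^sup>2) * sqrt (1 + z\<^sup>2))) (at z)"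
    using pos by (auto intro!: derivative_eq_intros simp: field_simps)
  moreover have "(sqrt (1 + z\<^sup>2) - z * (z / sqrt (1 + z\<^sup>2))) / (sqrt (1 + z\<^sup>2) * sqrt (1 + z\<^sup>2))
      = 1 / sqrt (1 + z\<^sup>2) ^ 3"
  proof -
    define s where "s = sqrt (1 + z\<^sup>2)"
    have s: "0 < s" "s * s = 1 + z\<^sup>2"
      using pos J by (auto simp: s_def)
    have "s - z * (z / s) = (s * s - z\<^sup>2) / s"
      using s(1) by (simp add: field_simps power2_eq_square)
    then show ?thesis
      using s by (simp add: power3_eq_cube flip: s_def)
  qed
  ultimately show ?thesis by simp
qed

section \<open>H2 functions and the admissible class\<close>

lemma H2_triple_continuous:
  assumes "H2_triple u u1 u2"
  shows "continuous_on {-1..1} u" "continuous_on {-1..1} u1"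
proof -
  show "continuous_on {-1..1} u"
  proof (rule DERIV_continuous_on)
    show "(u has_real_derivative u1 x) (at x within {-1..1})" if "x \<in> {-1..1}" for x
      using assms that unfolding H2_triple_def by blast
  qed
  have int: "set_integrable lborel {-1..1} u2"
    using assms by (simp add: H2_triple_def)
  have cont: "continuous_on {-1..1} (\<lambda>x. u1 (-1) + integral {-1..x} u2)"
    using set_borel_integral_eq_integral(1)[OF int]
    by (intro continuous_intros indefinite_integral_continuous_1)
  have eq: "u1 x = u1 (-1) + integral {-1..x} u2" if "x \<in> {-1..1}" for x
  proof -
    have "set_integrable lborel {-1..x} u2"
      using int that by (auto intro: set_integrable_subset)
    moreover have "u1 x = u1 (-1) + (\<integral>t\<in>{-1..x}. u2 t \<partial>lborel)"
      using assms that unfolding H2_triple_def by blast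
    ultimately show ?thesis
      by (simp only: set_borel_integral_eq_integral(2))
  qed
  show "continuous_on {-1..1} u1"
    by (rule continuous_on_eq[OF cont]) (rule eq[symmetric])
qed

lemma H2_triple_increment:
  assumes H: "H2_triple u u1 u2" and "-1 \<le> x" "x \<le> y" "y \<le> 1"
  shows "u1 y - u1 x = (\<integral>t\<in>{x..y}. u2 t \<partial>lborel)"
proof -
  have "set_integrable lborel {-1..1} u2"
    using H by (simp add: H2_triple_def)
  then have "set_integrable lborel {-1..y} u2"
    using assms by (auto intro: set_integrable_subset)
  from set_integral_combine[OF this \<open>-1 \<le> x\<close> \<open>x \<le> y\<close>]
  have "(\<integral>t\<in>{-1..y}. u2 t \<partial>lborel) - (\<integral>t\<in>{-1..x}. u2 t \<partial>lborel) = (\<integral>t\<in>{x..y}. u2 t \<partial>lborel)"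
    by simp
  moreover have "u1 z = u1 (-1) + (\<integral>t\<in>{-1..z}. u2 t \<partial>lborel)" if "z \<in> {-1..1}" for z
    using H that unfolding H2_triple_def by blast
  from this[of x] this[of y]
  have "u1 y - u1 x = (\<integral>t\<in>{-1..y}. u2 t \<partial>lborel) - (\<integral>t\<in>{-1..x}. u2 t \<partial>lborel)"
    using assms by simp
  ultimately show ?thesis by simp
qed

lemma H2_triple_sine_increment:
  assumes H: "H2_triple u u1 u2" and xy: "-1 \<le> x" "x \<le> y" "y \<le> 1"
  shows "u1 y / sqrt (1 + (u1 y)\<^sup>2) - u1 x / sqrt (1 + (u1 x)\<^sup>2)
    = (\<integral>t\<in>{x..y}. 1 / sqrt (1 + (u1 t)\<^sup>2) ^ 3 * u2 t \<partial>lborel)"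
proof (rule absolutely_continuous_chain_rule[where \<Phi>="\<lambda>z. z / sqrt (1 + z\<^sup>2)"
      and \<Phi>'="\<lambda>z. 1 / sqrt (1 + z\<^sup>2) ^ 3" and f=u1])
  have "set_integrable lborel {-1..1} u2"
    using H by (simp add: H2_triple_def)
  then show "set_integrable lborel {x..y} u2"
    using xy by (auto intro: set_integrable_subset)
  show "u1 q - u1 p = (\<integral>t\<in>{p..q}. u2 t \<partial>lborel)" if "x \<le> p" "p \<le> q" "q \<le> y" for p q
    using H2_triple_increment[OF H, of p q] that xy by auto
  show "continuous_on {x..y} u1"
    using H2_triple_continuous(2)[OF H] xy by (auto intro: continuous_on_subset)
  have "sqrt (1 + z\<^sup>2) \<noteq> 0" for z :: real
    by (smt (verit) real_sqrt_eq_zero_cancel_iff zero_le_power2)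
  then show "continuous_on UNIV (\<lambda>z::real. 1 / sqrt (1 + z\<^sup>2) ^ 3)"
    by (intro continuous_intros) auto
qed (use xy DERIV_sine_of_slope in auto)

lemma N_alpha_H2: "N_alpha \<alpha> u u1 u2 \<Longrightarrow> H2_triple u u1 u2"
  by (simp add: N_alpha_def)

text \<open>At x = 0 this supplies an interior zero of the slope. Uniqueness of the derivative
  within the closed interval covers the end points as well.\<close>

lemma N_alpha_odd_derivative:
  assumes N: "N_alpha \<alpha> u u1 u2" and x: "x \<in> {-1..1}"
  shows "u1 (-x) = - u1 x"
proof -
  have D: "(u has_real_derivative u1 z) (at z within {-1..1})" if "z \<in> {-1..1}" for z
    using N that unfolding N_alpha_def H2_triple_def by blast
  have img: "uminus ` {-1..1::real} = {-1..1}"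
    by (simp add: image_uminus_atLeastAtMost)
  have "((u \<circ> uminus) has_real_derivative u1 (-x) * (-1)) (at x within {-1..1})"
    using D[of "-x"] x
    by (intro DERIV_image_chain) (auto simp: img intro!: derivative_eq_intros)
  then have "(u has_real_derivative - u1 (-x)) (at x within {-1..1})"
    using N x by (auto simp: N_alpha_def elim!: has_field_derivative_transform_within[where d=1])
  then show ?thesis
    using D[OF x] x vector_derivative_unique_within_closed_interval[of "-1::real" 1 x u "u1 x" "- u1 (-x)"]
    by (simp add: has_real_derivative_iff_has_vector_derivative)
qed

lemma slope_root_pos: "0 < sqrt (1 + (z::real)\<^sup>2)"
  by (smt (verit) real_sqrt_gt_zero zero_le_power2)

lemma N_alpha_integrable:
  assumes N: "N_alpha \<alpha> u u1 u2"
  shows "continuous_on {-1..1} (\<lambda>x. sqrt (1 + (u1 x)\<^sup>2))"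
    and "set_integrable lborel {-1..1} (\<lambda>x. 1 / (u x * sqrt (1 + (u1 x)\<^sup>2)))"
    and "set_integrable lborel {-1..1} (\<lambda>x. u x * sqrt (1 + (u1 x)\<^sup>2))"
    and "set_integrable lborel {-1..1} (\<lambda>x. 1 / sqrt (1 + (u1 x)\<^sup>2) ^ 3 * u2 x)"
    and "set_integrable lborel {-1..1} (\<lambda>x. u x / sqrt (1 + (u1 x)\<^sup>2) ^ 5 * (u2 x)\<^sup>2)"
proof -
  note H = N_alpha_H2[OF N]
  note c = H2_triple_continuous[OF H]
  have pos: "\<And>x. x \<in> {-1..1} \<Longrightarrow> u x \<noteq> 0"
    using N by (force simp: N_alpha_def)
  have nz: "sqrt (1 + (u1 x)\<^sup>2) \<noteq> 0" for x
    using slope_root_pos[of "u1 x"] by linarith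
  show J: "continuous_on {-1..1} (\<lambda>x. sqrt (1 + (u1 x)\<^sup>2))"
    using c by (intro continuous_intros)
  show "set_integrable lborel {-1..1} (\<lambda>x. 1 / (u x * sqrt (1 + (u1 x)\<^sup>2)))"
    using pos nz by (intro set_integrable_continuous_Icc continuous_on_divide continuous_on_mult continuous_on_const c J)
      (simp add: no_zero_divisors)
  show "set_integrable lborel {-1..1} (\<lambda>x. u x * sqrt (1 + (u1 x)\<^sup>2))"
    by (intro set_integrable_continuous_Icc continuous_on_mult c J)
  show "set_integrable lborel {-1..1} (\<lambda>x. 1 / sqrt (1 + (u1 x)\<^sup>2) ^ 3 * u2 x)"
  proof (rule set_integrable_continuous_mult)
    show "continuous_on {-1..1} (\<lambda>x. 1 / sqrt (1 + (u1 x)\<^sup>2) ^ 3)"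
      using nz by (intro continuous_on_divide continuous_on_power continuous_on_const J) simp
  qed (use H in \<open>simp add: H2_triple_def\<close>)
  show "set_integrable lborel {-1..1} (\<lambda>x. u x / sqrt (1 + (u1 x)\<^sup>2) ^ 5 * (u2 x)\<^sup>2)"
  proof (rule set_integrable_continuous_mult)
    show "continuous_on {-1..1} (\<lambda>x. u x / sqrt (1 + (u1 x)\<^sup>2) ^ 5)"
      using nz by (intro continuous_on_divide continuous_on_power c J) simp
  qed (use H in \<open>simp add: H2_triple_def\<close>)
qed

text \<open>The cross term of the square integrates to the increment of the sine of the inclination
  angle, which vanishes because of the clamped boundary slopes.\<close>

lemma helfrich_fun_eq:
  assumes N: "N_alpha \<alpha> u u1 u2"
  shows "helfrich_fun \<epsilon> u u1 u2 = pi / 2 *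
    ((\<integral>x\<in>{-1..1}. 1 / (u x * sqrt (1 + (u1 x)\<^sup>2)) \<partial>lborel)
     + 4 * \<epsilon> * (\<integral>x\<in>{-1..1}. u x * sqrt (1 + (u1 x)\<^sup>2) \<partial>lborel)
     + (\<integral>x\<in>{-1..1}. u x / sqrt (1 + (u1 x)\<^sup>2) ^ 5 * (u2 x)\<^sup>2 \<partial>lborel))"
proof -
  note int = N_alpha_integrable[OF N]
  have expand: "(1 / (u x * sqrt (1 + (u1 x)\<^sup>2)) - u2 x / (sqrt (1 + (u1 x)\<^sup>2)) ^ 3)\<^sup>2
        * u x * sqrt (1 + (u1 x)\<^sup>2)
      = 1 / (u x * sqrt (1 + (u1 x)\<^sup>2)) - 2 * (1 / sqrt (1 + (u1 x)\<^sup>2) ^ 3 * u2 x)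
        + u x / sqrt (1 + (u1 x)\<^sup>2) ^ 5 * (u2 x)\<^sup>2" if "x \<in> {-1..1}" for x
  proof -
    define v J k where "v = u x" and "J = sqrt (1 + (u1 x)\<^sup>2)" and "k = u2 x"
    have "0 < v" "0 < J"
      using N that slope_root_pos[of "u1 x"] by (simp_all add: N_alpha_def v_def J_def)
    then have "(1 / (v * J) - k / J ^ 3)\<^sup>2 * v * J = 1 / (v * J) - 2 * (1 / J ^ 3 * k) + v / J ^ 5 * k\<^sup>2"
      by (simp add: field_simps power2_eq_square eval_nat_numeral)
    then show ?thesis by (simp add: v_def J_def k_def)
  qed
  have zero: "(\<integral>x\<in>{-1..1}. 1 / sqrt (1 + (u1 x)\<^sup>2) ^ 3 * u2 x \<partial>lborel) = 0"
    using H2_triple_sine_increment[OF N_alpha_H2[OF N], of "-1" 1] N by (simp add: N_alpha_def)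
  have "(\<integral>x\<in>{-1..1}. (1 / (u x * sqrt (1 + (u1 x)\<^sup>2)) - u2 x / (sqrt (1 + (u1 x)\<^sup>2)) ^ 3)\<^sup>2
        * u x * sqrt (1 + (u1 x)\<^sup>2) \<partial>lborel)
      = (\<integral>x\<in>{-1..1}. 1 / (u x * sqrt (1 + (u1 x)\<^sup>2)) - 2 * (1 / sqrt (1 + (u1 x)\<^sup>2) ^ 3 * u2 x)
        + u x / sqrt (1 + (u1 x)\<^sup>2) ^ 5 * (u2 x)\<^sup>2 \<partial>lborel)"
    using expand by (intro set_lebesgue_integral_cong) auto
  also have "\<dots> = (\<integral>x\<in>{-1..1}. 1 / (u x * sqrt (1 + (u1 x)\<^sup>2)) - 2 * (1 / sqrt (1 + (u1 x)\<^sup>2) ^ 3 * u2 x) \<partial>lborel)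
      + (\<integral>x\<in>{-1..1}. u x / sqrt (1 + (u1 x)\<^sup>2) ^ 5 * (u2 x)\<^sup>2 \<partial>lborel)"
    using int by (intro set_integral_add(2) set_integral_diff(1) set_integrable_mult_right)
  also have "(\<integral>x\<in>{-1..1}. 1 / (u x * sqrt (1 + (u1 x)\<^sup>2)) - 2 * (1 / sqrt (1 + (u1 x)\<^sup>2) ^ 3 * u2 x) \<partial>lborel)
      = (\<integral>x\<in>{-1..1}. 1 / (u x * sqrt (1 + (u1 x)\<^sup>2)) \<partial>lborel)
        - (\<integral>x\<in>{-1..1}. 2 * (1 / sqrt (1 + (u1 x)\<^sup>2) ^ 3 * u2 x) \<partial>lborel)"
    using int by (intro set_integral_diff(2) set_integrable_mult_right)
  also have "(\<integral>x\<in>{-1..1}. 2 * (1 / sqrt (1 + (u1 x)\<^sup>2) ^ 3 * u2 x) \<partial>lborel) = 0"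
    using zero by (subst set_integral_mult_right) simp
  finally show ?thesis
    unfolding helfrich_fun_def willmore_fun_def area_fun_def by (simp add: algebra_simps)
qed

lemma abs_set_integral_le:
  fixes f :: "'a \<Rightarrow> real"
  shows "\<bar>\<integral>x\<in>A. f x \<partial>M\<bar> \<le> (\<integral>x\<in>A. \<bar>f x\<bar> \<partial>M)"
  unfolding set_lebesgue_integral_def
  by (rule order_trans[OF integral_abs_bound]) (simp add: abs_mult)

text \<open>The factor 4 counts increments: at -1, -y, 0, y and 1 with y = |x| the sine of the
  inclination takes the values 0, -q, 0, q and 0, so each of the four pieces contributes at least
  |q|.\<close>

lemma N_alpha_sine_variation:
  assumes N: "N_alpha \<alpha> u u1 u2" and x: "x \<in> {-1..1}"
  shows "4 * \<bar>u1 x / sqrt (1 + (u1 x)\<^sup>2)\<bar> \<le> (\<integral>t\<in>{-1..1}. \<bar>1 / sqrt (1 + (u1 t)\<^sup>2) ^ 3 * u2 t\<bar> \<partial>lborel)"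
proof -
  define y where "y = \<bar>x\<bar>"
  define r where "r t = \<bar>1 / sqrt (1 + (u1 t)\<^sup>2) ^ 3 * u2 t\<bar>" for t
  define q where "q t = u1 t / sqrt (1 + (u1 t)\<^sup>2)" for t
  have y: "0 \<le> y" "y \<le> 1" using x by (auto simp: y_def)
  have r: "set_integrable lborel {-1..1} r"
    unfolding r_def by (intro set_integrable_abs N_alpha_integrable(4)[OF N])
  have inc: "\<bar>q b - q a\<bar> \<le> (\<integral>t\<in>{a..b}. r t \<partial>lborel)" if "-1 \<le> a" "a \<le> b" "b \<le> 1" for a b
    unfolding q_def r_def H2_triple_sine_increment[OF N_alpha_H2[OF N] that]
    by (rule abs_set_integral_le)
  have sub: "set_integrable lborel {a..b} r" if "-1 \<le> a" "b \<le> 1" for a b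
    using r that by (auto intro: set_integrable_subset)
  have odd: "u1 (-t) = - u1 t" if "t \<in> {-1..1}" for t
    using N_alpha_odd_derivative[OF N that] .
  have q: "q (-1) = 0" "q 1 = 0" "q 0 = 0" "q (-y) = - q y" "\<bar>q x\<bar> = \<bar>q y\<bar>"
    using N odd[of 0] odd[of y] odd[of x] x y by (auto simp: q_def N_alpha_def y_def abs_if)
  have "(\<integral>t\<in>{-1..1}. r t \<partial>lborel) = (\<integral>t\<in>{-1..-y}. r t \<partial>lborel) + (\<integral>t\<in>{-y..0}. r t \<partial>lborel)
      + (\<integral>t\<in>{0..y}. r t \<partial>lborel) + (\<integral>t\<in>{y..1}. r t \<partial>lborel)"
    using y set_integral_combine[OF sub, of "-1" 1 0] set_integral_combine[OF sub, of "-1" 0 "-y"]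
      set_integral_combine[OF sub, of 0 1 y] by simp
  then have "4 * \<bar>q x\<bar> \<le> (\<integral>t\<in>{-1..1}. r t \<partial>lborel)"
    using inc[of "-1" "-y"] inc[of "-y" 0] inc[of 0 y] inc[of y 1] q y by simp
  then show ?thesis by (simp add: q_def r_def)
qed

text \<open>Two squares are completed with \<open>k\<^sup>2 = 1 + \<epsilon>\<close>: one part of \<open>1 / Y\<close> pays for the
  curvature term, the other one for the area term.\<close>

lemma helfrich_density_ge:
  fixes Y r k \<epsilon> :: real
  assumes "0 < Y" "0 < k" "k\<^sup>2 = 1 + \<epsilon>" "0 \<le> \<epsilon>"
  shows "2 / k * \<bar>r\<bar> + 4 * \<epsilon> / k \<le> 1 / Y + 4 * \<epsilon> * Y + Y * r\<^sup>2"
proof -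
  have "0 \<le> (Y * \<bar>r\<bar> - 1 / k)\<^sup>2 / Y + \<epsilon> * (1 / k - 2 * Y)\<^sup>2 / Y"
    using assms by (intro add_nonneg_nonneg divide_nonneg_pos mult_nonneg_nonneg) auto
  also have "\<dots> = Y * r\<^sup>2 + 4 * \<epsilon> * Y + (1 + \<epsilon>) / (k\<^sup>2 * Y) - 2 / k * \<bar>r\<bar> - 4 * \<epsilon> / k"
  proof -
    have "(Y * \<bar>r\<bar> - 1 / k)\<^sup>2 / Y = Y * r\<^sup>2 - 2 / k * \<bar>r\<bar> + 1 / (k\<^sup>2 * Y)"
      using assms(1,2) by (simp add: power2_diff power_mult_distrib diff_divide_distrib add_divide_distrib
          power_divide power2_eq_square[of Y] mult.commute)
    moreover have "\<epsilon> * (1 / k - 2 * Y)\<^sup>2 / Y = 4 * \<epsilon> * Y - 4 * \<epsilon> / k + \<epsilon> / (k\<^sup>2 * Y)"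
      using assms(1,2) by (simp add: field_simps power2_eq_square)
    ultimately show ?thesis by (simp add: add_divide_distrib)
  qed
  also have "(1 + \<epsilon>) / (k\<^sup>2 * Y) = 1 / Y"
    using assms by simp
  finally show ?thesis by simp
qed

text \<open>With Y = u J and r the derivative of the sine of the inclination, the curvature density
  u u''^2 / J^5 is Y r^2, so the pointwise bound can be integrated. The variation estimate
  contributes 8 / k times the sine, the interval length 2 contributes 8 \<epsilon> / k.\<close>

lemma helfrich_fun_ge_slope:
  assumes N: "N_alpha \<alpha> u u1 u2" and "0 \<le> \<epsilon>" and x: "x \<in> {-1..1}"
  shows "4 * pi * (\<bar>u1 x / sqrt (1 + (u1 x)\<^sup>2)\<bar> + \<epsilon>) / sqrt (1 + \<epsilon>) \<le> helfrich_fun \<epsilon> u u1 u2"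
proof -
  define k where "k = sqrt (1 + \<epsilon>)"
  have k: "0 < k" "k\<^sup>2 = 1 + \<epsilon>"
    using \<open>0 \<le> \<epsilon>\<close> by (auto simp: k_def)
  define J where "J x = sqrt (1 + (u1 x)\<^sup>2)" for x
  define r where "r t = 1 / J t ^ 3 * u2 t" for t
  note int = N_alpha_integrable[OF N, folded J_def, folded r_def]
  have density: "2 / k * \<bar>r t\<bar> + 4 * \<epsilon> / k
      \<le> 1 / (u t * J t) + 4 * \<epsilon> * (u t * J t) + u t / J t ^ 5 * (u2 t)\<^sup>2" if "t \<in> {-1..1}" for t
  proof -
    have J: "0 < J t" using slope_root_pos by (simp add: J_def)
    moreover have u: "0 < u t" using N that by (simp add: N_alpha_def)
    moreover have "u t * J t * (r t)\<^sup>2 = u t / J t ^ 5 * (u2 t)\<^sup>2"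
      using J u by (simp add: r_def field_simps power2_eq_square eval_nat_numeral)
    ultimately show ?thesis
      using helfrich_density_ge[of "u t * J t" k \<epsilon> "r t"] k \<open>0 \<le> \<epsilon>\<close> by (simp add: mult.assoc)
  qed
  have int_r: "set_integrable lborel {-1..1} (\<lambda>t. \<bar>r t\<bar>)"
    using int(4) by (rule set_integrable_abs)
  have int_c: "set_integrable lborel {-1..1::real} (\<lambda>t. c)" for c :: real
    by (intro set_integrable_continuous_Icc continuous_on_const)
  have "8 / k * \<bar>u1 x / J x\<bar> + 8 * \<epsilon> / k \<le> 2 / k * (\<integral>t\<in>{-1..1}. \<bar>r t\<bar> \<partial>lborel) + 8 * \<epsilon> / k"
    using mult_left_mono[OF N_alpha_sine_variation[OF N x, folded J_def, folded r_def], of "2 / k"] k(1)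
    by simp
  also have "\<dots> = (\<integral>t\<in>{-1..1}. 2 / k * \<bar>r t\<bar> \<partial>lborel) + (\<integral>t\<in>{-1..1::real}. 4 * \<epsilon> / k \<partial>lborel)"
    by (subst set_integral_mult_right) (simp add: set_integral_const)
  also have "\<dots> = (\<integral>t\<in>{-1..1}. 2 / k * \<bar>r t\<bar> + 4 * \<epsilon> / k \<partial>lborel)"
    using int_r int_c by (intro set_integral_add(2)[symmetric] set_integrable_mult_right)
  also have "\<dots> \<le> (\<integral>t\<in>{-1..1}. 1 / (u t * J t) + 4 * \<epsilon> * (u t * J t) + u t / J t ^ 5 * (u2 t)\<^sup>2 \<partial>lborel)"
    using int_r int_c int density by (intro set_integral_mono set_integral_add(1) set_integrable_mult_right)
  also have "\<dots> = (\<integral>t\<in>{-1..1}. 1 / (u t * J t) + 4 * \<epsilon> * (u t * J t) \<partial>lborel)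
      + (\<integral>t\<in>{-1..1}. u t / J t ^ 5 * (u2 t)\<^sup>2 \<partial>lborel)"
    using int by (intro set_integral_add set_integrable_mult_right)
  also have "(\<integral>t\<in>{-1..1}. 1 / (u t * J t) + 4 * \<epsilon> * (u t * J t) \<partial>lborel)
      = (\<integral>t\<in>{-1..1}. 1 / (u t * J t) \<partial>lborel) + (\<integral>t\<in>{-1..1}. 4 * \<epsilon> * (u t * J t) \<partial>lborel)"
    using int by (intro set_integral_add(2) set_integrable_mult_right)
  also have "(\<integral>t\<in>{-1..1}. 4 * \<epsilon> * (u t * J t) \<partial>lborel) = 4 * \<epsilon> * (\<integral>t\<in>{-1..1}. u t * J t \<partial>lborel)"
    by (rule set_integral_mult_right)
  finally have "pi / 2 * (8 / k * \<bar>u1 x / J x\<bar> + 8 * \<epsilon> / k) \<le> helfrich_fun \<epsilon> u u1 u2"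
    unfolding helfrich_fun_eq[OF N] J_def by (intro mult_left_mono) auto
  moreover have "pi / 2 * (8 / k * \<bar>u1 x / J x\<bar> + 8 * \<epsilon> / k) = 4 * pi * (\<bar>u1 x / J x\<bar> + \<epsilon>) / k"
    using k(1) by (simp add: field_simps)
  ultimately show ?thesis by (simp add: J_def k_def)
qed

section \<open>Uniform bounds on energy sublevels\<close>

lemma slope_bound_of_sine_bound:
  fixes z s :: real
  assumes "\<bar>z / sqrt (1 + z\<^sup>2)\<bar> \<le> s" "0 \<le> s" "s < 1"
  shows "sqrt (1 + z\<^sup>2) \<le> 1 / sqrt (1 - s\<^sup>2)"
proof -
  have s: "0 < 1 - s\<^sup>2"
    using assms by (simp add: power_less_one_iff abs_square_less_1)
  have "(z / sqrt (1 + z\<^sup>2))\<^sup>2 \<le> s\<^sup>2"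
    using power_mono[OF assms(1), of 2] by (simp only: power2_abs abs_ge_zero)
  moreover have "(z / sqrt (1 + z\<^sup>2))\<^sup>2 = z\<^sup>2 / (1 + z\<^sup>2)"
    by (simp add: power_divide)
  moreover have "0 < 1 + z\<^sup>2"
    by (smt (verit) zero_le_power2)
  ultimately have "z\<^sup>2 \<le> s\<^sup>2 * (1 + z\<^sup>2)"
    by (simp add: divide_le_eq)
  then have "(1 + z\<^sup>2) * (1 - s\<^sup>2) \<le> 1"
    by (simp add: algebra_simps)
  then have "1 + z\<^sup>2 \<le> 1 / (1 - s\<^sup>2)"
    using s by (simp add: le_divide_eq)
  then have "sqrt (1 + z\<^sup>2) \<le> sqrt (1 / (1 - s\<^sup>2))"
    by (rule real_sqrt_le_mono)
  then show ?thesis by (simp add: real_sqrt_divide)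
qed

lemma set_integral_nonneg:
  fixes f :: "'a \<Rightarrow> real"
  assumes "\<And>x. x \<in> A \<Longrightarrow> 0 \<le> f x"
  shows "0 \<le> (\<integral>x\<in>A. f x \<partial>M)"
  unfolding set_lebesgue_integral_def using assms
  by (intro Bochner_Integration.integral_nonneg) (auto simp: indicator_def)

text \<open>The logarithm is the right quantity because, for bounded slopes, |u'| / u is dominated
  by a multiple of 1 / (u J), the first term of the energy. It keeps \<open>u\<close> away from 0 as
  well as from infinity.\<close>

lemma N_alpha_log_bound:
  assumes N: "N_alpha \<alpha> u u1 u2" and x: "x \<in> {-1..1}"
  shows "\<bar>ln (u x) - ln \<alpha>\<bar> \<le> (\<integral>t\<in>{-1..1}. \<bar>u1 t / u t\<bar> \<partial>lborel)"
proof -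
  note c = H2_triple_continuous[OF N_alpha_H2[OF N]]
  have pos: "0 < u t" if "t \<in> {-1..1}" for t
    using N that by (simp add: N_alpha_def)
  have D: "(u has_real_derivative u1 t) (at t within {-1..1})" if "t \<in> {-1..1}" for t
    using N that unfolding N_alpha_def H2_triple_def by blast
  have int: "set_integrable lborel {-1..1} (\<lambda>t. u1 t / u t)"
    using pos by (intro set_integrable_continuous_Icc continuous_on_divide c) force
  have intx: "set_integrable lborel {-1..x} (\<lambda>t. u1 t / u t)"
    using int x by (auto intro: set_integrable_subset)
  have "((\<lambda>t. u1 t / u t) has_integral (ln (u x) - ln (u (-1)))) {-1..x}"
  proof (rule fundamental_theorem_of_calculus)
    fix t assume t: "t \<in> {-1..x}"
    then have "((\<lambda>t. ln (u t)) has_real_derivative u1 t / u t) (at t within {-1..1})"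
      using D[of t] pos[of t] x by (auto intro!: derivative_eq_intros simp: divide_inverse)
    then show "((\<lambda>t. ln (u t)) has_vector_derivative u1 t / u t) (at t within {-1..x})"
      unfolding has_real_derivative_iff_has_vector_derivative
      by (rule has_vector_derivative_within_subset) (use x in auto)
  qed (use x in auto)
  then have "ln (u x) - ln \<alpha> = (\<integral>t\<in>{-1..x}. u1 t / u t \<partial>lborel)"
    using N intx by (simp add: set_borel_integral_eq_integral(2) integral_unique N_alpha_def)
  then have "\<bar>ln (u x) - ln \<alpha>\<bar> \<le> (\<integral>t\<in>{-1..x}. \<bar>u1 t / u t\<bar> \<partial>lborel)"
    using abs_set_integral_le by metis
  also have "\<dots> \<le> (\<integral>t\<in>{-1..x}. \<bar>u1 t / u t\<bar> \<partial>lborel) + (\<integral>t\<in>{x..1}. \<bar>u1 t / u t\<bar> \<partial>lborel)"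
    using set_integral_nonneg[of "{x..1}" "\<lambda>t. \<bar>u1 t / u t\<bar>"] by simp
  also have "\<dots> = (\<integral>t\<in>{-1..1}. \<bar>u1 t / u t\<bar> \<partial>lborel)"
    using x int by (intro set_integral_combine[symmetric] set_integrable_abs) auto
  finally show ?thesis .
qed

text \<open>All constants are fixed before \<open>u\<close> is given, as compactness needs. The
  order is slope, height, second derivative: each bound makes the next weight controllable. The
  strict inequality for \<open>H0\<close> is what yields s < 1.\<close>

lemma helfrich_sublevel_bounds:
  assumes "0 < \<alpha>" "0 \<le> \<epsilon>" and H0: "H0 < 4 * pi * sqrt (1 + \<epsilon>)"
  obtains B m U K where "1 \<le> B" "0 < m" "0 < K"
    "\<And>u u1 u2. N_alpha \<alpha> u u1 u2 \<Longrightarrow> helfrich_fun \<epsilon> u u1 u2 \<le> H0 \<Longrightarrow>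
      (\<forall>x\<in>{-1..1}. sqrt (1 + (u1 x)\<^sup>2) \<le> B \<and> m \<le> u x \<and> u x \<le> U) \<and>
      (\<integral>x\<in>{-1..1}. (u2 x)\<^sup>2 \<partial>lborel) \<le> K"
proof -
  define k where "k = sqrt (1 + \<epsilon>)"
  have k: "0 < k" "k * k = 1 + \<epsilon>"
    using \<open>0 \<le> \<epsilon>\<close> by (auto simp: k_def)
  \<comment> \<open>This is the slope estimate solved for the sine; the maximum with 0 makes
    \<open>s\<close> admissible whatever \<open>H0\<close> is.\<close>
  define s where "s = max 0 (H0 * k / (4 * pi) - \<epsilon>)"
  have "H0 * k < 4 * pi * (k * k)"
    using mult_strict_right_mono[OF H0 k(1)] by (simp add: k_def mult.assoc)
  then have "H0 * k / (4 * pi) < 1 + \<epsilon>"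
    unfolding k(2) by (simp add: divide_less_eq mult.commute)
  then have s: "0 \<le> s" "s < 1"
    by (auto simp: s_def)
  define B where "B = 1 / sqrt (1 - s\<^sup>2)"
  have "1 \<le> B"
    using slope_bound_of_sine_bound[of 0 s] s by (simp add: B_def)
  \<comment> \<open>\<open>Q\<close> is the energy bound without the factor pi / 2; it bounds the
    sum of the three nonnegative energy terms.\<close>
  define Q where "Q = 2 * \<bar>H0\<bar> / pi"
  have Q: "0 \<le> Q" by (simp add: Q_def)
  \<comment> \<open>\<open>E\<close> bounds the distance of ln u from ln \<alpha>: by |u'| J \<le>
    B^2, the quotient |u'| / u is at most B^2 times 1 / (u J).\<close>
  define E where "E = B * B * Q"
  define m where "m = \<alpha> * exp (- E)"
  define U where "U = \<alpha> * exp E"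
  have m: "0 < m" using \<open>0 < \<alpha>\<close> by (simp add: m_def)
  \<comment> \<open>The summand 1 keeps \<open>K\<close> positive, since it later serves as a
    divisor in the modulus of continuity.\<close>
  define K where "K = Q * B ^ 5 / m + 1"
  have K: "0 < K"
    using Q m \<open>1 \<le> B\<close> by (auto simp: K_def intro!: add_nonneg_pos)
  show thesis
  proof (rule that[of B m K U])
    fix u u1 u2 assume N: "N_alpha \<alpha> u u1 u2" and H: "helfrich_fun \<epsilon> u u1 u2 \<le> H0"
    define J where "J x = sqrt (1 + (u1 x)\<^sup>2)" for x
    note int = N_alpha_integrable[OF N, folded J_def]
    have J0: "0 < J x" for x using slope_root_pos by (simp add: J_def)
    have J1: "\<bar>u1 x\<bar> \<le> J x" for x
      unfolding J_def by (rule real_le_rsqrt) simp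
    have pos: "0 < u x" if "x \<in> {-1..1}" for x
      using N that by (simp add: N_alpha_def)
    have JB: "J x \<le> B" if "x \<in> {-1..1}" for x
    proof -
      have "4 * pi * (\<bar>u1 x / J x\<bar> + \<epsilon>) / k \<le> H0"
        using helfrich_fun_ge_slope[OF N \<open>0 \<le> \<epsilon>\<close> that] H by (simp add: J_def k_def)
      then have "\<bar>u1 x / J x\<bar> \<le> H0 * k / (4 * pi) - \<epsilon>"
        using k(1) by (simp add: field_simps)
      then have "\<bar>u1 x / J x\<bar> \<le> s" by (simp add: s_def)
      then show ?thesis
        unfolding B_def J_def using s by (intro slope_bound_of_sine_bound)
    qed
    have parts: "0 \<le> (\<integral>x\<in>{-1..1}. 1 / (u x * J x) \<partial>lborel)" "0 \<le> (\<integral>x\<in>{-1..1}. u x * J x \<partial>lborel)"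
      "0 \<le> (\<integral>x\<in>{-1..1}. u x / J x ^ 5 * (u2 x)\<^sup>2 \<partial>lborel)"
      using less_imp_le[OF pos] less_imp_le[OF J0] by (auto intro!: set_integral_nonneg)
    have total: "(\<integral>x\<in>{-1..1}. 1 / (u x * J x) \<partial>lborel) + 4 * \<epsilon> * (\<integral>x\<in>{-1..1}. u x * J x \<partial>lborel)
       + (\<integral>x\<in>{-1..1}. u x / J x ^ 5 * (u2 x)\<^sup>2 \<partial>lborel) \<le> Q" (is "?T \<le> Q")
    proof -
      have "pi / 2 * ?T \<le> \<bar>H0\<bar>"
        using H unfolding helfrich_fun_eq[OF N] J_def by linarith
      then show ?thesis by (simp add: Q_def field_simps)
    qed
    have "0 \<le> 4 * \<epsilon> * (\<integral>x\<in>{-1..1}. u x * J x \<partial>lborel)"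
      using parts \<open>0 \<le> \<epsilon>\<close> by simp
    then have Q1: "(\<integral>x\<in>{-1..1}. 1 / (u x * J x) \<partial>lborel) \<le> Q"
      and Q2: "(\<integral>x\<in>{-1..1}. u x / J x ^ 5 * (u2 x)\<^sup>2 \<partial>lborel) \<le> Q"
      using total parts by linarith+
    have log: "\<bar>ln (u x) - ln \<alpha>\<bar> \<le> E" if "x \<in> {-1..1}" for x
    proof -
      have "(\<integral>t\<in>{-1..1}. \<bar>u1 t / u t\<bar> \<partial>lborel) \<le> (\<integral>t\<in>{-1..1}. B * B * (1 / (u t * J t)) \<partial>lborel)"
      proof (rule set_integral_mono)
        note c = H2_triple_continuous[OF N_alpha_H2[OF N]]
        show "set_integrable lborel {-1..1} (\<lambda>t. \<bar>u1 t / u t\<bar>)"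
          using pos by (intro set_integrable_abs set_integrable_continuous_Icc continuous_on_divide c) force
        show "set_integrable lborel {-1..1} (\<lambda>t. B * B * (1 / (u t * J t)))"
          using int by (intro set_integrable_mult_right)
        fix t :: real assume t: "t \<in> {-1..1}"
        have "\<bar>u1 t\<bar> * J t \<le> B * B"
          using JB[OF t] J1[of t] J0[of t] \<open>1 \<le> B\<close> by (intro mult_mono) auto
        then have "\<bar>u1 t\<bar> \<le> B * B / J t"
          using J0 by (simp add: le_divide_eq)
        then have "\<bar>u1 t\<bar> / u t \<le> B * B / J t / u t"
          using pos[OF t] by (intro divide_right_mono) auto
        then show "\<bar>u1 t / u t\<bar> \<le> B * B * (1 / (u t * J t))"
          using pos[OF t] by (simp add: mult.commute)
      qed
      also have "\<dots> = B * B * (\<integral>t\<in>{-1..1}. 1 / (u t * J t) \<partial>lborel)"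
        by (rule set_integral_mult_right)
      also have "\<dots> \<le> E"
        unfolding E_def using Q1 by (intro mult_left_mono) auto
      finally show ?thesis
        using N_alpha_log_bound[OF N that] by linarith
    qed
    have ub: "m \<le> u x" "u x \<le> U" if "x \<in> {-1..1}" for x
    proof -
      have "ln \<alpha> + - E \<le> ln (u x)" "ln (u x) \<le> ln \<alpha> + E"
        using log[OF that] by linarith+
      then have "exp (ln \<alpha> + - E) \<le> exp (ln (u x))" "exp (ln (u x)) \<le> exp (ln \<alpha> + E)"
        by simp_all
      then show "m \<le> u x" "u x \<le> U"
        using pos[OF that] \<open>0 < \<alpha>\<close> by (simp_all only: exp_add exp_ln m_def U_def)
    qed
    have "(\<integral>x\<in>{-1..1}. (u2 x)\<^sup>2 \<partial>lborel)
        \<le> (\<integral>x\<in>{-1..1}. B ^ 5 / m * (u x / J x ^ 5 * (u2 x)\<^sup>2) \<partial>lborel)"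
    proof (rule set_integral_mono)
      show "set_integrable lborel {-1..1} (\<lambda>x. (u2 x)\<^sup>2)"
        using N by (simp add: N_alpha_def H2_triple_def)
      show "set_integrable lborel {-1..1} (\<lambda>x. B ^ 5 / m * (u x / J x ^ 5 * (u2 x)\<^sup>2))"
        using int by (intro set_integrable_mult_right)
      fix x :: real assume x: "x \<in> {-1..1}"
      have "J x ^ 5 \<le> B ^ 5"
        using JB[OF x] J0[of x] by (intro power_mono) auto
      then have "1 * m \<le> B ^ 5 / J x ^ 5 * u x"
        using J0[of x] ub(1)[OF x] m \<open>1 \<le> B\<close> by (intro mult_mono) auto
      then have "1 \<le> B ^ 5 / m * (u x / J x ^ 5)"
        using m J0[of x] by (simp add: field_simps)
      from mult_right_mono[OF this, of "(u2 x)\<^sup>2"]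
      show "(u2 x)\<^sup>2 \<le> B ^ 5 / m * (u x / J x ^ 5 * (u2 x)\<^sup>2)"
        by (simp add: mult.assoc)
    qed
    also have "\<dots> = B ^ 5 / m * (\<integral>x\<in>{-1..1}. u x / J x ^ 5 * (u2 x)\<^sup>2 \<partial>lborel)"
      by (rule set_integral_mult_right)
    also have "\<dots> \<le> B ^ 5 / m * Q"
      using Q2 m \<open>1 \<le> B\<close> by (intro mult_left_mono) auto
    also have "\<dots> \<le> K"
      by (simp add: K_def mult.commute)
    finally have u2K: "(\<integral>x\<in>{-1..1}. (u2 x)\<^sup>2 \<partial>lborel) \<le> K" .
    show "(\<forall>x\<in>{-1..1}. sqrt (1 + (u1 x)\<^sup>2) \<le> B \<and> m \<le> u x \<and> u x \<le> U) \<and>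
      (\<integral>x\<in>{-1..1}. (u2 x)\<^sup>2 \<partial>lborel) \<le> K"
      using JB ub u2K by (simp add: J_def)
  qed (use \<open>1 \<le> B\<close> m K in auto)
qed

subsection \<open>Compactness of minimising sequences\<close>

lemma set_integral_diff_le:
  fixes f g w :: "'a \<Rightarrow> real"
  assumes "set_integrable M A f" "set_integrable M A g" "set_integrable M A w"
    and "\<And>x. x \<in> A \<Longrightarrow> \<bar>f x - g x\<bar> \<le> e * w x"
  shows "\<bar>(\<integral>x\<in>A. f x \<partial>M) - (\<integral>x\<in>A. g x \<partial>M)\<bar> \<le> e * (\<integral>x\<in>A. w x \<partial>M)"
proof -
  have "\<bar>(\<integral>x\<in>A. f x \<partial>M) - (\<integral>x\<in>A. g x \<partial>M)\<bar> = \<bar>\<integral>x\<in>A. f x - g x \<partial>M\<bar>"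
    using assms by simp
  also have "\<dots> \<le> (\<integral>x\<in>A. \<bar>f x - g x\<bar> \<partial>M)"
    by (rule abs_set_integral_le)
  also have "\<dots> \<le> (\<integral>x\<in>A. e * w x \<partial>M)"
    using assms by (intro set_integral_mono set_integrable_abs set_integral_diff set_integrable_mult_right)
  also have "\<dots> = e * (\<integral>x\<in>A. w x \<partial>M)"
    by (rule set_integral_mult_right)
  finally show ?thesis .
qed

text \<open>The weight is absorbed: sqrt \<rho> times \<open>v n\<close> goes through the unweighted
  weak limit, and the result is divided by sqrt \<rho>. The positive lower bound on \<rho> keeps the
  test functions bounded. Only primitives are tested, since these are what \<open>H2_triple\<close>
  speaks of.\<close>

lemma weighted_L2_weak_limit:
  fixes v :: "nat \<Rightarrow> real \<Rightarrow> real" and \<rho> G :: "real \<Rightarrow> real"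
  assumes \<rho>: "continuous_on {a..b} \<rho>" "\<And>x. x \<in> {a..b} \<Longrightarrow> c0 \<le> \<rho> x" "0 < c0"
    and v: "\<And>n. set_integrable lborel {a..b} (v n)" "\<And>n. set_integrable lborel {a..b} (\<lambda>x. (v n x)\<^sup>2)"
    and C: "(\<lambda>n. \<integral>x\<in>{a..b}. \<rho> x * (v n x)\<^sup>2 \<partial>lborel) \<longlonglongrightarrow> C"
    and G: "\<And>x. x \<in> {a..b} \<Longrightarrow> (\<lambda>n. \<integral>t\<in>{a..x}. v n t \<partial>lborel) \<longlonglongrightarrow> G x"
  obtains f where "set_integrable lborel {a..b} f" "set_integrable lborel {a..b} (\<lambda>x. (f x)\<^sup>2)"
    "(\<integral>x\<in>{a..b}. \<rho> x * (f x)\<^sup>2 \<partial>lborel) \<le> C"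
    "\<forall>x\<in>{a..b}. (\<integral>t\<in>{a..x}. f t \<partial>lborel) = G x"
proof -
  define M where "M = restrict_space lborel {a..b}"
  have sp: "space M = {a..b}"
    by (simp add: M_def space_restrict_space)
  have int_M: "integrable M F \<longleftrightarrow> set_integrable lborel {a..b} F" for F :: "real \<Rightarrow> real"
    unfolding M_def set_integrable_def by (rule integrable_restrict_space) simp
  have eq_M: "(\<integral>x. F x \<partial>M) = (\<integral>x\<in>{a..b}. F x \<partial>lborel)" for F :: "real \<Rightarrow> real"
    unfolding M_def set_lebesgue_integral_def by (rule integral_restrict_space) simp
  interpret finite_measure M
    by (rule finite_measureI) (simp add: M_def emeasure_restrict_space space_restrict_space emeasure_lborel_Icc_eq)
  define s where "s x = sqrt (\<rho> x)" for x
  have s: "continuous_on {a..b} s"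
    unfolding s_def using \<rho>(1) by (intro continuous_intros)
  have \<rho>0: "0 < \<rho> x" if "x \<in> {a..b}" for x
    using \<rho>(2)[OF that] \<rho>(3) by linarith
  have s2: "0 < s x" "(s x)\<^sup>2 = \<rho> x" if "x \<in> {a..b}" for x
    using \<rho>0[OF that] by (auto simp: s_def)
  have s_ge: "sqrt c0 \<le> s x" if "x \<in> {a..b}" for x
    using \<rho>(2)[OF that] by (simp add: s_def)
  have meas_cont: "F \<in> borel_measurable M" if "continuous_on {a..b} F" for F :: "real \<Rightarrow> real"
    unfolding M_def using borel_measurable_continuous_on_restrict[OF that]
    by (simp add: measurable_def space_restrict_space sets_restrict_space)
  define h where "h n x = s x * v n x" for n x
  have h_meas: "h n \<in> borel_measurable M" for n
    unfolding h_def using meas_cont[OF s] v(1)[of n] by (auto simp flip: int_M)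
  have h_sq: "(h n x)\<^sup>2 = \<rho> x * (v n x)\<^sup>2" if "x \<in> {a..b}" for n x
    using s2[OF that] by (simp add: h_def power_mult_distrib)
  have "set_integrable lborel {a..b} (\<lambda>x. \<rho> x * (v n x)\<^sup>2)" for n
    using v(2) \<rho>(1) by (rule set_integrable_continuous_mult)
  then have h_int: "integrable M (\<lambda>x. (h n x)\<^sup>2)" for n
    unfolding int_M by (subst set_integrable_cong[OF refl refl h_sq])
  have "(\<integral>x. (h n x)\<^sup>2 \<partial>M) = (\<integral>x\<in>{a..b}. \<rho> x * (v n x)\<^sup>2 \<partial>lborel)" for n
    unfolding eq_M using h_sq by (intro set_lebesgue_integral_cong) auto
  then have h_lim: "(\<lambda>n. \<integral>x. (h n x)\<^sup>2 \<partial>M) \<longlonglongrightarrow> C"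
    using C by simp
  obtain g where g: "g \<in> borel_measurable M" "integrable M (\<lambda>x. (g x)\<^sup>2)" "(\<integral>x. (g x)\<^sup>2 \<partial>M) \<le> C"
    and test: "\<And>\<phi> B L. \<phi> \<in> borel_measurable M \<Longrightarrow> (\<And>x. \<bar>\<phi> x\<bar> \<le> B) \<Longrightarrow>
       (\<lambda>k. \<integral>x. h k x * \<phi> x \<partial>M) \<longlonglongrightarrow> L \<Longrightarrow> (\<integral>x. g x * \<phi> x \<partial>M) = L"
    using L2_weak_limit[OF h_meas h_int h_lim] by blast
  define f where "f x = g x / s x" for x
  have inv_s: "continuous_on {a..b} (\<lambda>x. 1 / s x)"
    using s s2(1) by (intro continuous_on_divide continuous_on_const) force+
  have f_meas: "f \<in> borel_measurable M"
    unfolding f_def using g(1) meas_cont[OF s] by measurable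
  have "set_integrable lborel {a..b} (\<lambda>x. (1 / s x)\<^sup>2 * (g x)\<^sup>2)"
    using g(2) inv_s unfolding int_M by (intro set_integrable_continuous_mult continuous_on_power)
  then have f_sq: "set_integrable lborel {a..b} (\<lambda>x. (f x)\<^sup>2)"
    by (simp add: f_def power_divide)
  have f_int: "set_integrable lborel {a..b} f"
    using integrable_of_square[OF f_meas] f_sq by (simp add: int_M)
  have \<rho>f: "\<rho> x * (f x)\<^sup>2 = (g x)\<^sup>2" if "x \<in> {a..b}" for x
    using s2[OF that] \<rho>0[OF that] by (simp add: f_def power_divide)
  show thesis
  proof (rule that[OF f_int f_sq])
    have "(\<integral>x\<in>{a..b}. \<rho> x * (f x)\<^sup>2 \<partial>lborel) = (\<integral>x\<in>{a..b}. (g x)\<^sup>2 \<partial>lborel)"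
      using \<rho>f by (intro set_lebesgue_integral_cong) auto
    then show "(\<integral>x\<in>{a..b}. \<rho> x * (f x)\<^sup>2 \<partial>lborel) \<le> C"
      using g(3) by (simp add: eq_M)
    show "\<forall>x\<in>{a..b}. (\<integral>t\<in>{a..x}. f t \<partial>lborel) = G x"
    proof
      fix x assume x: "x \<in> {a..b}"
      \<comment> \<open>Testing with the indicator of [a, x] divided by sqrt \<rho> undoes the
        weight and leaves the primitive of \<open>v n\<close> at x.\<close>
      define \<phi> where "\<phi> t = indicator {a..x} t * (1 / s t)" for t
      have sub: "{a..x} \<subseteq> {a..b}" using x by auto
      have test_eq: "(\<integral>t. F t * \<phi> t \<partial>M) = (\<integral>t\<in>{a..x}. F t / s t \<partial>lborel)" for F
        unfolding eq_M set_lebesgue_integral_def \<phi>_def using sub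
        by (intro Bochner_Integration.integral_cong) (auto simp: indicator_def)
      have "(\<integral>t. g t * \<phi> t \<partial>M) = G x"
      proof (rule test)
        have "(indicator {a..x} :: real \<Rightarrow> real) \<in> borel_measurable M"
          unfolding M_def by (intro measurable_restrict_space1) auto
        then show "\<phi> \<in> borel_measurable M"
          unfolding \<phi>_def using meas_cont[OF inv_s] by (rule borel_measurable_times)
        show "\<bar>\<phi> t\<bar> \<le> 1 / sqrt c0" for t
        proof (cases "t \<in> {a..x}")
          case True
          then have t: "t \<in> {a..b}" using sub by auto
          have "1 / s t \<le> 1 / sqrt c0"
            using s_ge[OF t] \<rho>(3) s2(1)[OF t] by (intro divide_left_mono) auto
          then show ?thesis
            using s2(1)[OF t] True by (simp add: \<phi>_def)
        qed (use \<rho>(3) in \<open>simp add: \<phi>_def\<close>)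
        have "(\<integral>t. h n t * \<phi> t \<partial>M) = (\<integral>t\<in>{a..x}. v n t \<partial>lborel)" for n
          unfolding test_eq
        proof (rule set_lebesgue_integral_cong)
          show "\<forall>t. t \<in> {a..x} \<longrightarrow> h n t / s t = v n t"
            using s2(1) sub by (force simp: h_def)
        qed simp
        then show "(\<lambda>n. \<integral>t. h n t * \<phi> t \<partial>M) \<longlonglongrightarrow> G x"
          using G[OF x] by simp
      qed
      then show "(\<integral>t\<in>{a..x}. f t \<partial>lborel) = G x"
        unfolding test_eq f_def .
    qed
  qed
qed

text \<open>A Hoelder bound of exponent 1/2 in unoptimised form: the weight \<open>e\<close> stays
  free, so that no square roots appear.\<close>

lemma H2_triple_slope_modulus:
  assumes H: "H2_triple u u1 u2" and xy: "-1 \<le> x" "x \<le> y" "y \<le> 1" and "0 < e"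
  shows "2 * \<bar>u1 y - u1 x\<bar> \<le> e * (y - x) + (\<integral>t\<in>{-1..1}. (u2 t)\<^sup>2 \<partial>lborel) / e"
proof -
  have i: "set_integrable lborel {-1..1} u2" "set_integrable lborel {-1..1} (\<lambda>t. (u2 t)\<^sup>2)"
    using H by (simp_all add: H2_triple_def)
  then have ixy: "set_integrable lborel {x..y} u2" "set_integrable lborel {x..y} (\<lambda>t. (u2 t)\<^sup>2)"
    using xy by (auto intro: set_integrable_subset)
  have ic: "set_integrable lborel {x..y} (\<lambda>t. e)"
    by (intro set_integrable_continuous_Icc continuous_on_const)
  have "2 * \<bar>u1 y - u1 x\<bar> \<le> 2 * (\<integral>t\<in>{x..y}. \<bar>u2 t\<bar> \<partial>lborel)"
    unfolding H2_triple_increment[OF H xy] using abs_set_integral_le by simp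
  also have "\<dots> = (\<integral>t\<in>{x..y}. 2 * \<bar>u2 t\<bar> \<partial>lborel)"
    by (rule set_integral_mult_right[symmetric])
  also have "\<dots> \<le> (\<integral>t\<in>{x..y}. e + (u2 t)\<^sup>2 / e \<partial>lborel)"
    using ixy ic two_abs_le_weighted_square[OF \<open>0 < e\<close>]
    by (intro set_integral_mono set_integral_add set_integrable_mult_right set_integrable_abs) auto
  also have "\<dots> = (\<integral>t\<in>{x..y}. e \<partial>lborel) + (\<integral>t\<in>{x..y}. (u2 t)\<^sup>2 / e \<partial>lborel)"
    using ixy ic by (intro set_integral_add) auto
  also have "\<dots> = e * (y - x) + (\<integral>t\<in>{x..y}. (u2 t)\<^sup>2 \<partial>lborel) / e"
    using xy by (simp add: set_integral_const mult.commute)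
  also have "(\<integral>t\<in>{x..y}. (u2 t)\<^sup>2 \<partial>lborel) \<le> (\<integral>t\<in>{-1..1}. (u2 t)\<^sup>2 \<partial>lborel)"
  proof -
    have "set_integrable lborel {x..1} (\<lambda>t. (u2 t)\<^sup>2)"
      using i(2) xy by (auto intro: set_integrable_subset)
    then have "(\<integral>t\<in>{-1..1}. (u2 t)\<^sup>2 \<partial>lborel) = (\<integral>t\<in>{-1..x}. (u2 t)\<^sup>2 \<partial>lborel)
        + ((\<integral>t\<in>{x..y}. (u2 t)\<^sup>2 \<partial>lborel) + (\<integral>t\<in>{y..1}. (u2 t)\<^sup>2 \<partial>lborel))"
      using set_integral_combine[OF i(2), of x] set_integral_combine[of x 1 _ y] xy by simp
    then show ?thesis
      using set_integral_nonneg[of "{-1..x}" "\<lambda>t. (u2 t)\<^sup>2" lborel]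
        set_integral_nonneg[of "{y..1}" "\<lambda>t. (u2 t)\<^sup>2" lborel] by simp
  qed
  finally show ?thesis
    using \<open>0 < e\<close> by (simp add: divide_right_mono)
qed

lemma N_alpha_eq_integral:
  assumes N: "N_alpha \<alpha> u u1 u2" and x: "x \<in> {-1..1}"
  shows "u x = \<alpha> + integral {-1..x} u1"
proof -
  have D: "(u has_real_derivative u1 t) (at t within {-1..1})" if "t \<in> {-1..1}" for t
    using N that unfolding N_alpha_def H2_triple_def by blast
  have "(u1 has_integral (u x - u (-1))) {-1..x}"
  proof (rule fundamental_theorem_of_calculus)
    fix t assume "t \<in> {-1..x}"
    then have "(u has_real_derivative u1 t) (at t within {-1..x})"
      using D[of t] x by (auto intro: DERIV_subset)
    then show "(u has_vector_derivative u1 t) (at t within {-1..x})"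
      by (simp add: has_real_derivative_iff_has_vector_derivative)
  qed (use x in auto)
  then show ?thesis
    using N by (simp add: integral_unique N_alpha_def)
qed

lemma uniform_limit_of_continuous_pair:
  fixes u v :: "nat \<Rightarrow> 'a \<Rightarrow> real" and \<Psi> :: "real \<times> real \<Rightarrow> real"
  assumes \<Psi>: "continuous_on (S \<times> T) \<Psi>" "compact S" "compact T"
    and u: "uniform_limit X u u0 sequentially" "\<And>n x. x \<in> X \<Longrightarrow> u n x \<in> S" "\<And>x. x \<in> X \<Longrightarrow> u0 x \<in> S"
    and v: "uniform_limit X v v0 sequentially" "\<And>n x. x \<in> X \<Longrightarrow> v n x \<in> T" "\<And>x. x \<in> X \<Longrightarrow> v0 x \<in> T"
  shows "uniform_limit X (\<lambda>n x. \<Psi> (u n x, v n x)) (\<lambda>x. \<Psi> (u0 x, v0 x)) sequentially"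
proof (rule uniform_limitI)
  fix e :: real assume "0 < e"
  have "uniformly_continuous_on (S \<times> T) \<Psi>"
    using \<Psi> by (intro compact_uniformly_continuous compact_Times)
  then obtain d where d: "0 < d"
    "\<And>p q. p \<in> S \<times> T \<Longrightarrow> q \<in> S \<times> T \<Longrightarrow> dist q p < d \<Longrightarrow> dist (\<Psi> q) (\<Psi> p) < e"
    using \<open>0 < e\<close> unfolding uniformly_continuous_on_def by metis
  have "\<forall>\<^sub>F n in sequentially. \<forall>x\<in>X. dist (u n x) (u0 x) < d / 2"
    "\<forall>\<^sub>F n in sequentially. \<forall>x\<in>X. dist (v n x) (v0 x) < d / 2"
    using u(1) v(1) d(1) by (auto dest: uniform_limitD[where e="d / 2"])
  then show "\<forall>\<^sub>F n in sequentially. \<forall>x\<in>X. dist (\<Psi> (u n x, v n x)) (\<Psi> (u0 x, v0 x)) < e"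
  proof eventually_elim
    case (elim n)
    show ?case
    proof
      fix x assume x: "x \<in> X"
      have "dist (u n x, v n x) (u0 x, v0 x) \<le> dist (u n x) (u0 x) + dist (v n x) (v0 x)"
        unfolding dist_Pair_Pair by (rule sqrt_sum_squares_le_sum) auto
      also have "\<dots> < d"
        using elim x by fastforce
      finally show "dist (\<Psi> (u n x, v n x)) (\<Psi> (u0 x, v0 x)) < e"
        using u v x by (intro d(2)) auto
    qed
  qed
qed

text \<open>The weights \<open>w n\<close> are controlled through a common bound on their integrals,
  which suits squares of second derivatives. With w = 1 this gives convergence of the lower-order
  terms; with w = u''^2 it freezes the coefficient of the curvature term.\<close>

lemma tendsto_set_integral_uniform:
  fixes f :: "nat \<Rightarrow> 'a \<Rightarrow> real" and w :: "nat \<Rightarrow> 'a \<Rightarrow> real"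
  assumes lim: "uniform_limit A f g sequentially"
    and f: "\<And>n. set_integrable M A (\<lambda>x. f n x * w n x)" and g: "\<And>n. set_integrable M A (\<lambda>x. g x * w n x)"
    and w: "\<And>n. set_integrable M A (w n)" "\<And>n x. 0 \<le> w n x" "\<And>n. (\<integral>x\<in>A. w n x \<partial>M) \<le> K"
  shows "(\<lambda>n. (\<integral>x\<in>A. f n x * w n x \<partial>M) - (\<integral>x\<in>A. g x * w n x \<partial>M)) \<longlonglongrightarrow> 0"
proof (rule LIMSEQ_I)
  fix e :: real assume "0 < e"
  have K: "0 \<le> K"
    using w(3)[of 0] set_integral_nonneg[of A "w 0" M] w(2) by (metis order_trans)
  define d where "d = e / (K + 1)"
  have d: "0 < d" "d * K < e"
    using \<open>0 < e\<close> K by (auto simp: d_def field_simps)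
  from uniform_limitD[OF lim d(1)]
  obtain N where N: "\<And>n x. N \<le> n \<Longrightarrow> x \<in> A \<Longrightarrow> \<bar>f n x - g x\<bar> < d"
    unfolding eventually_sequentially dist_real_def by blast
  have "norm ((\<integral>x\<in>A. f n x * w n x \<partial>M) - (\<integral>x\<in>A. g x * w n x \<partial>M) - 0) < e" if "N \<le> n" for n
  proof -
    have "\<bar>f n x * w n x - g x * w n x\<bar> \<le> d * w n x" if "x \<in> A" for x
      using mult_right_mono[OF less_imp_le[OF N[OF \<open>N \<le> n\<close> that]] w(2)[of n x]] w(2)[of n x]
      by (simp add: abs_mult flip: left_diff_distrib)
    then have "\<bar>(\<integral>x\<in>A. f n x * w n x \<partial>M) - (\<integral>x\<in>A. g x * w n x \<partial>M)\<bar> \<le> d * (\<integral>x\<in>A. w n x \<partial>M)"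
      by (intro set_integral_diff_le f g w)
    also have "\<dots> \<le> d * K"
      using d(1) w(3) by (intro mult_left_mono) auto
    finally show ?thesis
      using d(2) by simp
  qed
  then show "\<exists>N. \<forall>n\<ge>N. norm ((\<integral>x\<in>A. f n x * w n x \<partial>M) - (\<integral>x\<in>A. g x * w n x \<partial>M) - 0) < e"
    by blast
qed

lemma N_alpha_slopes_compact:
  assumes N: "\<And>n. N_alpha \<alpha> (v n) (v1 n) (v2 n)"
    and B: "\<And>n x. x \<in> {-1..1} \<Longrightarrow> \<bar>v1 n x\<bar> \<le> B"
    and K: "\<And>n. (\<integral>x\<in>{-1..1}. (v2 n x)\<^sup>2 \<partial>lborel) \<le> K" "0 < K"
  obtains g r where "continuous_on {-1..1} g" "strict_mono (r :: nat \<Rightarrow> nat)"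
    "uniform_limit {-1..1} (\<lambda>n. v1 (r n)) g sequentially"
proof -
  have mod: "\<bar>v1 n x - v1 n y\<bar> < e" if "x \<in> {-1..1}" "y \<in> {-1..1}" "\<bar>x - y\<bar> < e * e / K" "0 < e" for n x y e
  proof -
    have le: "\<bar>v1 n q - v1 n p\<bar> < e" if "-1 \<le> p" "p \<le> q" "q \<le> 1" "q - p < e * e / K" for p q
    proof -
      \<comment> \<open>With weight K / e and q - p < e^2 / K, the first term of the modulus is
        below e and the second at most e, together less than 2 e.\<close>
      have "0 < K / e" using K(2) \<open>0 < e\<close> by simp
      from H2_triple_slope_modulus[OF N_alpha_H2[OF N[of n]] that(1-3) this]
      have "2 * \<bar>v1 n q - v1 n p\<bar>
          \<le> K / e * (q - p) + (\<integral>t\<in>{-1..1}. (v2 n t)\<^sup>2 \<partial>lborel) / (K / e)" .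
      also have "(\<integral>t\<in>{-1..1}. (v2 n t)\<^sup>2 \<partial>lborel) / (K / e) \<le> K / (K / e)"
        using K(1)[of n] \<open>0 < K / e\<close> by (intro divide_right_mono) auto
      also have "K / (K / e) = e" using K(2) by simp
      also have "K / e * (q - p) < K / e * (e * e / K)"
        using that(4) \<open>0 < K / e\<close> by (intro mult_strict_left_mono)
      also have "K / e * (e * e / K) = e" using K(2) \<open>0 < e\<close> by simp
      finally show ?thesis by simp
    qed
    show ?thesis
    proof (cases "x \<le> y")
      case True
      then show ?thesis using le[of x y] that by (simp add: abs_minus_commute)
    next
      case False
      then show ?thesis using le[of y x] that by simp
    qed
  qed
  obtain g r where gr: "continuous_on {-1..1} g" "strict_mono (r :: nat \<Rightarrow> nat)"
    "\<And>e. 0 < e \<Longrightarrow> \<exists>N. \<forall>n x. n \<ge> N \<and> x \<in> {-1..1} \<longrightarrow> norm (v1 (r n) x - g x) < e"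
  proof (rule Arzela_Ascoli[of "{-1..1::real}" v1 B])
    show "\<exists>d>0. \<forall>n y. y \<in> {-1..1} \<and> norm (x - y) < d \<longrightarrow> norm (v1 n x - v1 n y) < e"
      if "x \<in> {-1..1}" "0 < e" for x e
      using mod[OF that(1) _ _ that(2)] that(2) K(2)
      by (intro exI[of _ "e * e / K"]) auto
  qed (use B in auto)
  have "uniform_limit {-1..1} (\<lambda>n. v1 (r n)) g sequentially"
  proof (rule uniform_limitI)
    fix e :: real assume "0 < e"
    from gr(3)[OF this] show "\<forall>\<^sub>F n in sequentially. \<forall>x\<in>{-1..1}. dist (v1 (r n) x) (g x) < e"
      unfolding eventually_sequentially dist_norm by blast
  qed
  then show thesis using that gr by blast
qed

text \<open>The common value \<alpha> at -1 lets heights be recovered from slopes by integration;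
  over a length of at most 2 a slope error of e / 3 stays below e.\<close>

lemma N_alpha_heights_uniform_limit:
  assumes N: "\<And>n. N_alpha \<alpha> (v n) (v1 n) (v2 n)"
    and g: "continuous_on {-1..1} g" "uniform_limit {-1..1} v1 g sequentially"
  shows "uniform_limit {-1..1} v (\<lambda>x. \<alpha> + integral {-1..x} g) sequentially"
proof (rule uniform_limitI)
  fix e :: real assume "0 < e"
  then have "0 < e / 3" by simp
  from uniform_limitD[OF g(2) this]
  show "\<forall>\<^sub>F n in sequentially. \<forall>x\<in>{-1..1}. dist (v n x) (\<alpha> + integral {-1..x} g) < e"
  proof eventually_elim
    case (elim n)
    show ?case
    proof
      fix x :: real assume x: "x \<in> {-1..1}"
      note c = H2_triple_continuous(2)[OF N_alpha_H2[OF N[of n]]]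
      have i: "v1 n integrable_on {-1..x}" "g integrable_on {-1..x}"
        using c g(1) x by (auto intro!: integrable_continuous_real intro: continuous_on_subset)
      have "dist (v n x) (\<alpha> + integral {-1..x} g) = norm (integral {-1..x} (\<lambda>t. v1 n t - g t))"
        using N_alpha_eq_integral[OF N x] i by (simp add: dist_real_def Henstock_Kurzweil_Integration.integral_diff)
      also have "\<dots> \<le> e / 3 * (x - -1)"
        using x elim i c g(1)
        by (intro integral_bound continuous_on_diff) (auto simp: dist_real_def less_imp_le intro: continuous_on_subset)
      also have "\<dots> \<le> e / 3 * 2"
        using x \<open>0 < e\<close> by (intro mult_left_mono) auto
      also have "\<dots> < e" using \<open>0 < e\<close> by simp
      finally show "dist (v n x) (\<alpha> + integral {-1..x} g) < e" .
    qed
  qed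
qed

section \<open>Lower semicontinuity and existence of minimisers\<close>

lemma helfrich_fun_nonneg:
  assumes "N_alpha \<alpha> u u1 u2" "0 \<le> \<epsilon>"
  shows "0 \<le> helfrich_fun \<epsilon> u u1 u2"
proof -
  have "0 \<le> 4 * pi * (\<bar>u1 1 / sqrt (1 + (u1 1)\<^sup>2)\<bar> + \<epsilon>) / sqrt (1 + \<epsilon>)"
    using assms by simp
  also have "\<dots> \<le> helfrich_fun \<epsilon> u u1 u2"
    using assms by (intro helfrich_fun_ge_slope) auto
  finally show ?thesis .
qed

text \<open>The first two integrals pass to the limit under uniform convergence, so the curvature
  integral converges too, to what the energy limit leaves over. Energy can be lost only in the weak
  limit of the second derivatives, which is the harmless direction.\<close>

lemma helfrich_minimising_limit:
  assumes N: "\<And>n. N_alpha \<alpha> (v n) (v1 n) (v2 n)"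
    and lim: "(\<lambda>n. helfrich_fun \<epsilon> (v n) (v1 n) (v2 n)) \<longlonglongrightarrow> I"
    and bd: "\<And>n x. x \<in> {-1..1} \<Longrightarrow> sqrt (1 + (v1 n x)\<^sup>2) \<le> B \<and> m \<le> v n x \<and> v n x \<le> U" "0 < m"
    and K: "\<And>n. (\<integral>x\<in>{-1..1}. (v2 n x)\<^sup>2 \<partial>lborel) \<le> K" "0 < K"
  obtains u u1 u2 where "N_alpha \<alpha> u u1 u2" "helfrich_fun \<epsilon> u u1 u2 \<le> I"
proof -
  have v1_le: "\<bar>v1 n x\<bar> \<le> B" if "x \<in> {-1..1}" for n x
  proof -
    have "\<bar>v1 n x\<bar> \<le> sqrt (1 + (v1 n x)\<^sup>2)"
      by (rule real_le_rsqrt) simp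
    then show ?thesis using bd(1)[OF that, of n] by linarith
  qed
  obtain g r where g: "continuous_on {-1..1} g" "strict_mono (r :: nat \<Rightarrow> nat)"
    and ul1: "uniform_limit {-1..1} (\<lambda>n. v1 (r n)) g sequentially"
    by (rule N_alpha_slopes_compact[OF N v1_le K])
  define w w1 w2 where "w n = v (r n)" and "w1 n = v1 (r n)" and "w2 n = v2 (r n)" for n
  define u where "u x = \<alpha> + integral {-1..x} g" for x
  have Nw: "N_alpha \<alpha> (w n) (w1 n) (w2 n)" for n
    using N by (simp add: w_def w1_def w2_def)
  have ul1: "uniform_limit {-1..1} w1 g sequentially"
    using ul1 by (simp add: w1_def[abs_def])
  have ul: "uniform_limit {-1..1} w u sequentially"
    unfolding u_def by (rule N_alpha_heights_uniform_limit[OF Nw g(1) ul1])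
  have limw: "(\<lambda>n. helfrich_fun \<epsilon> (w n) (w1 n) (w2 n)) \<longlonglongrightarrow> I"
    using LIMSEQ_subseq_LIMSEQ[OF lim g(2)] by (simp add: w_def w1_def w2_def o_def)
  have pt: "(\<lambda>n. w n x) \<longlonglongrightarrow> u x" "(\<lambda>n. w1 n x) \<longlonglongrightarrow> g x" if "x \<in> {-1..1}" for x
    using tendsto_uniform_limitI[OF ul that] tendsto_uniform_limitI[OF ul1 that] .
  have w_in: "w n x \<in> {m..U}" "w1 n x \<in> {-B..B}" if "x \<in> {-1..1}" for n x
    using bd(1)[OF that] v1_le[OF that, of "r n"] by (auto simp: w_def w1_def abs_le_iff)
  have u_in: "u x \<in> {m..U}" "g x \<in> {-B..B}" if "x \<in> {-1..1}" for x
    using closed_sequentially[OF closed_real_atLeastAtMost w_in(1)[OF that] pt(1)[OF that]]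
      closed_sequentially[OF closed_real_atLeastAtMost w_in(2)[OF that] pt(2)[OF that]] by auto
  have nz: "sqrt (1 + z\<^sup>2) \<noteq> 0" for z :: real
    using slope_root_pos[of z] by linarith
  have cu: "continuous_on {-1..1} u"
    unfolding u_def using g(1) by (intro continuous_intros indefinite_integral_continuous_1 integrable_continuous_real)
  \<comment> \<open>The coefficients of the energy as functions of height and slope; all pairs lie
    in one compact rectangle, where these functions are uniformly continuous.\<close>
  define \<Psi>1 \<Psi>2 \<Psi>3 :: "real \<times> real \<Rightarrow> real"
    where "\<Psi>1 = (\<lambda>z. 1 / (fst z * sqrt (1 + (snd z)\<^sup>2)))"
      and "\<Psi>2 = (\<lambda>z. fst z * sqrt (1 + (snd z)\<^sup>2))"
      and "\<Psi>3 = (\<lambda>z. fst z / sqrt (1 + (snd z)\<^sup>2) ^ 5)"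
  have c\<Psi>: "continuous_on ({m..U} \<times> {-B..B}) \<Psi>1" "continuous_on ({m..U} \<times> {-B..B}) \<Psi>2"
    "continuous_on ({m..U} \<times> {-B..B}) \<Psi>3"
    unfolding \<Psi>1_def \<Psi>2_def \<Psi>3_def using nz \<open>0 < m\<close> by (auto intro!: continuous_intros)
  have c_lim: "continuous_on {-1..1} (\<lambda>x. \<Psi> (u x, g x))"
    and ul\<Psi>: "uniform_limit {-1..1} (\<lambda>n x. \<Psi> (w n x, w1 n x)) (\<lambda>x. \<Psi> (u x, g x)) sequentially"
    if "continuous_on ({m..U} \<times> {-B..B}) \<Psi>" for \<Psi> :: "real \<times> real \<Rightarrow> real"
  proof -
    show "continuous_on {-1..1} (\<lambda>x. \<Psi> (u x, g x))"
      using u_in by (intro continuous_on_compose2[OF that] continuous_on_Pair cu g(1)) auto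
    show "uniform_limit {-1..1} (\<lambda>n x. \<Psi> (w n x, w1 n x)) (\<lambda>x. \<Psi> (u x, g x)) sequentially"
      using w_in u_in by (intro uniform_limit_of_continuous_pair[OF that] ul ul1) auto
  qed
  have c_seq: "continuous_on {-1..1} (\<lambda>x. \<Psi> (w n x, w1 n x))"
    if "continuous_on ({m..U} \<times> {-B..B}) \<Psi>" for \<Psi> :: "real \<times> real \<Rightarrow> real" and n
    using w_in H2_triple_continuous[OF N_alpha_H2[OF Nw]]
    by (intro continuous_on_compose2[OF that] continuous_on_Pair) auto
  have one: "set_integrable lborel {-1..1::real} (\<lambda>x. 1::real)"
    by (intro set_integrable_continuous_Icc continuous_on_const)
  have lim\<Psi>: "(\<lambda>n. \<integral>x\<in>{-1..1}. \<Psi> (w n x, w1 n x) \<partial>lborel) \<longlonglongrightarrow> (\<integral>x\<in>{-1..1}. \<Psi> (u x, g x) \<partial>lborel)"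
    if "continuous_on ({m..U} \<times> {-B..B}) \<Psi>" for \<Psi> :: "real \<times> real \<Rightarrow> real"
    using tendsto_set_integral_uniform[OF ul\<Psi>[OF that], of lborel "\<lambda>n x. 1" 2] one
      set_integrable_continuous_Icc[OF c_lim[OF that]] set_integrable_continuous_Icc[OF c_seq[OF that]]
    by (simp add: set_integral_const LIM_zero_iff)
  have w2: "set_integrable lborel {-1..1} (w2 n)" "set_integrable lborel {-1..1} (\<lambda>x. (w2 n x)\<^sup>2)" for n
    using Nw[of n] by (simp_all add: N_alpha_def H2_triple_def)
  have K2: "(\<integral>x\<in>{-1..1}. (w2 n x)\<^sup>2 \<partial>lborel) \<le> K" for n
    using K by (simp add: w2_def)
  define P where "P = (\<integral>x\<in>{-1..1}. \<Psi>1 (u x, g x) \<partial>lborel) + 4 * \<epsilon> * (\<integral>x\<in>{-1..1}. \<Psi>2 (u x, g x) \<partial>lborel)"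
  define C where "C = 2 / pi * I - P"
  have energy: "c = 2 / pi * (pi / 2 * (a + b + c)) - (a + b)" for a b c :: real
    by (simp add: field_simps)
  have "(\<integral>x\<in>{-1..1}. \<Psi>3 (w n x, w1 n x) * (w2 n x)\<^sup>2 \<partial>lborel) =
      2 / pi * helfrich_fun \<epsilon> (w n) (w1 n) (w2 n) - ((\<integral>x\<in>{-1..1}. \<Psi>1 (w n x, w1 n x) \<partial>lborel)
      + 4 * \<epsilon> * (\<integral>x\<in>{-1..1}. \<Psi>2 (w n x, w1 n x) \<partial>lborel))" for n
    unfolding helfrich_fun_eq[OF Nw] \<Psi>1_def \<Psi>2_def \<Psi>3_def fst_conv snd_conv by (rule energy)
  moreover have "(\<lambda>n. 2 / pi * helfrich_fun \<epsilon> (w n) (w1 n) (w2 n) - ((\<integral>x\<in>{-1..1}. \<Psi>1 (w n x, w1 n x) \<partial>lborel)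
      + 4 * \<epsilon> * (\<integral>x\<in>{-1..1}. \<Psi>2 (w n x, w1 n x) \<partial>lborel))) \<longlonglongrightarrow> C"
    unfolding C_def P_def by (intro tendsto_intros limw lim\<Psi> c\<Psi>)
  ultimately have lim3: "(\<lambda>n. \<integral>x\<in>{-1..1}. \<Psi>3 (w n x, w1 n x) * (w2 n x)\<^sup>2 \<partial>lborel) \<longlonglongrightarrow> C"
    by simp
  \<comment> \<open>The coefficient may be replaced by its limit, since the squares of
    \<open>w2 n\<close> have integrals at most \<open>K\<close>.\<close>
  have "(\<lambda>n. (\<integral>x\<in>{-1..1}. \<Psi>3 (w n x, w1 n x) * (w2 n x)\<^sup>2 \<partial>lborel)
      - (\<integral>x\<in>{-1..1}. \<Psi>3 (u x, g x) * (w2 n x)\<^sup>2 \<partial>lborel)) \<longlonglongrightarrow> 0"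
    using c_seq[OF c\<Psi>(3)] c_lim[OF c\<Psi>(3)] w2 K2
    by (intro tendsto_set_integral_uniform[OF ul\<Psi>[OF c\<Psi>(3)]] set_integrable_continuous_mult) auto
  from tendsto_diff[OF lim3 this]
  have limC: "(\<lambda>n. \<integral>x\<in>{-1..1}. \<Psi>3 (u x, g x) * (w2 n x)\<^sup>2 \<partial>lborel) \<longlonglongrightarrow> C"
    by simp
  \<comment> \<open>The bounds on slopes and heights keep the curvature weight away from 0, as the
    weighted weak limit requires.\<close>
  have bend_ge: "m / sqrt (1 + B\<^sup>2) ^ 5 \<le> \<Psi>3 (u x, g x)" if "x \<in> {-1..1}" for x
  proof -
    have "(g x)\<^sup>2 \<le> B\<^sup>2"
      using u_in(2)[OF that] by (intro abs_le_square_iff[THEN iffD1]) auto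
    then have "sqrt (1 + (g x)\<^sup>2) ^ 5 \<le> sqrt (1 + B\<^sup>2) ^ 5"
      by (intro power_mono) auto
    then show ?thesis
      unfolding \<Psi>3_def fst_conv snd_conv
      using u_in(1)[OF that] \<open>0 < m\<close> slope_root_pos[of "g x"] by (intro frac_le) auto
  qed
  have lim_w2: "(\<lambda>n. \<integral>t\<in>{-1..x}. w2 n t \<partial>lborel) \<longlonglongrightarrow> g x - g (-1)" if "x \<in> {-1..1}" for x
  proof -
    have "(\<lambda>n. w1 n x - w1 n (-1)) \<longlonglongrightarrow> g x - g (-1)"
      using that by (intro tendsto_diff pt) auto
    then show ?thesis
      using H2_triple_increment[OF N_alpha_H2[OF Nw], of "-1" x] that by simp
  qed
  have bend_pos: "0 < m / sqrt (1 + B\<^sup>2) ^ 5"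
    using \<open>0 < m\<close> slope_root_pos[of B] by (intro divide_pos_pos zero_less_power)
  obtain f where f: "set_integrable lborel {-1..1} f" "set_integrable lborel {-1..1} (\<lambda>x. (f x)\<^sup>2)"
    "(\<integral>x\<in>{-1..1}. \<Psi>3 (u x, g x) * (f x)\<^sup>2 \<partial>lborel) \<le> C"
    "\<forall>x\<in>{-1..1}. (\<integral>t\<in>{-1..x}. f t \<partial>lborel) = g x - g (-1)"
    by (rule weighted_L2_weak_limit[OF c_lim[OF c\<Psi>(3)] bend_ge bend_pos w2 limC lim_w2])
  have "(u has_real_derivative g x) (at x within {-1..1})" if "x \<in> {-1..1}" for x
    unfolding u_def using integral_has_real_derivative[OF g(1) that]
    by (auto intro!: derivative_eq_intros)
  then have H2: "H2_triple u g f"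
    unfolding H2_triple_def using f by simp
  have even: "u (-x) = u x" if "x \<in> {-1..1}" for x
  proof (rule LIMSEQ_unique[OF pt(1)])
    have "w n (-x) = w n x" for n
      using Nw[of n] that by (simp add: N_alpha_def)
    then show "(\<lambda>n. w n (-x)) \<longlonglongrightarrow> u x"
      using pt(1)[OF that] by simp
  qed (use that in auto)
  have ends: "u 1 = \<alpha>" "u (-1) = \<alpha>" "g 1 = 0" "g (-1) = 0"
    using Nw pt(1)[of 1] pt(1)[of "-1"] pt(2)[of 1] pt(2)[of "-1"]
    by (auto simp: N_alpha_def LIMSEQ_const_iff)
  have pos: "0 < u x" if "x \<in> {-1..1}" for x
    using u_in(1)[OF that] \<open>0 < m\<close> by simp
  have Nu: "N_alpha \<alpha> u g f"
    unfolding N_alpha_def using H2 even ends pos by blast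
  have "helfrich_fun \<epsilon> u g f = pi / 2 * (P + (\<integral>x\<in>{-1..1}. \<Psi>3 (u x, g x) * (f x)\<^sup>2 \<partial>lborel))"
    unfolding helfrich_fun_eq[OF Nu] P_def \<Psi>1_def \<Psi>2_def \<Psi>3_def fst_conv snd_conv ..
  also have "\<dots> \<le> pi / 2 * (P + C)"
    using f(3) by (intro mult_left_mono) auto
  also have "\<dots> = I"
    by (simp add: C_def)
  finally show thesis
    using that Nu by blast
qed

text \<open>The competitor \<open>w\<close> does double duty: it shows that the class is nonempty,
  and it keeps the minimising sequence in a sublevel set where the uniform bounds hold.\<close>

lemma helfrich_minimiser_exists:
  assumes "0 < \<alpha>" "0 \<le> \<epsilon>" and w: "N_alpha \<alpha> w w1 w2"
    and less: "helfrich_fun \<epsilon> w w1 w2 < 4 * pi * sqrt (1 + \<epsilon>)"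
  shows "\<exists>u u1 u2. N_alpha \<alpha> u u1 u2 \<and>
           (\<forall>v v1 v2. N_alpha \<alpha> v v1 v2 \<longrightarrow> helfrich_fun \<epsilon> u u1 u2 \<le> helfrich_fun \<epsilon> v v1 v2)"
proof -
  define H where "H = (\<lambda>(u, u1, u2). helfrich_fun \<epsilon> u u1 u2)"
  define S where "S = {(u, u1, u2). N_alpha \<alpha> u u1 u2}"
  define I where "I = Inf (H ` S)"
  have bdd: "bdd_below (H ` S)"
    using helfrich_fun_nonneg[OF _ \<open>0 \<le> \<epsilon>\<close>] by (intro bdd_belowI[of _ 0]) (auto simp: H_def S_def)
  have I_le: "I \<le> helfrich_fun \<epsilon> u u1 u2" if "N_alpha \<alpha> u u1 u2" for u u1 u2
    unfolding I_def using that by (intro cInf_lower bdd) (force simp: H_def S_def)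
  \<comment> \<open>An almost minimal element with more energy than \<open>w\<close> is replaced by
    \<open>w\<close> itself, which is then even closer to the infimum.\<close>
  have "\<exists>t\<in>S. H t < I + 1 / Suc n \<and> H t \<le> H (w, w1, w2)" for n
  proof -
    have "H ` S \<noteq> {}" using w by (auto simp: S_def)
    then obtain t where t: "t \<in> S" "H t < I + 1 / Suc n"
      using cInf_lessD[of "H ` S" "I + 1 / Suc n"] by (auto simp: I_def)
    have "(w, w1, w2) \<in> S" using w by (simp add: S_def)
    then show ?thesis
      using t by (metis le_less_trans linear order.refl)
  qed
  then obtain t where t: "\<And>n. t n \<in> S" "\<And>n. H (t n) < I + 1 / Suc n" "\<And>n. H (t n) \<le> H (w, w1, w2)"
    by metis
  define v v1 v2 where "v n = fst (t n)" and "v1 n = fst (snd (t n))" and "v2 n = snd (snd (t n))" for n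
  have t_eq: "t n = (v n, v1 n, v2 n)" for n
    by (simp add: v_def v1_def v2_def)
  have N: "N_alpha \<alpha> (v n) (v1 n) (v2 n)" for n
    using t(1)[of n] by (simp add: t_eq S_def)
  have le: "helfrich_fun \<epsilon> (v n) (v1 n) (v2 n) \<le> helfrich_fun \<epsilon> w w1 w2"
    "helfrich_fun \<epsilon> (v n) (v1 n) (v2 n) < I + 1 / Suc n" for n
    using t(2,3)[of n] by (simp_all add: t_eq H_def)
  have "(\<lambda>n. I + 1 / Suc n) \<longlonglongrightarrow> I + 0"
    using LIMSEQ_inverse_real_of_nat by (intro tendsto_add tendsto_const) (simp add: divide_inverse)
  then have upper: "(\<lambda>n. I + 1 / Suc n) \<longlonglongrightarrow> I"
    by simp
  have lim: "(\<lambda>n. helfrich_fun \<epsilon> (v n) (v1 n) (v2 n)) \<longlonglongrightarrow> I"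
  proof (rule tendsto_sandwich[OF _ _ tendsto_const upper])
    show "\<forall>\<^sub>F n in sequentially. I \<le> helfrich_fun \<epsilon> (v n) (v1 n) (v2 n)"
      by (intro always_eventually allI I_le N)
    show "\<forall>\<^sub>F n in sequentially. helfrich_fun \<epsilon> (v n) (v1 n) (v2 n) \<le> I + 1 / Suc n"
      by (intro always_eventually allI less_imp_le le)
  qed
  obtain B m K U where "0 < m" "0 < K" and
    bounds: "\<And>u u1 u2. N_alpha \<alpha> u u1 u2 \<Longrightarrow> helfrich_fun \<epsilon> u u1 u2 \<le> helfrich_fun \<epsilon> w w1 w2 \<Longrightarrow>
      (\<forall>x\<in>{-1..1}. sqrt (1 + (u1 x)\<^sup>2) \<le> B \<and> m \<le> u x \<and> u x \<le> U) \<and>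
      (\<integral>x\<in>{-1..1}. (u2 x)\<^sup>2 \<partial>lborel) \<le> K"
    using helfrich_sublevel_bounds[OF assms(1,2) less] by metis
  obtain u u1 u2 where "N_alpha \<alpha> u u1 u2" "helfrich_fun \<epsilon> u u1 u2 \<le> I"
    using helfrich_minimising_limit[OF N lim, of B m U K] bounds[OF N le(1)] \<open>0 < m\<close> \<open>0 < K\<close> by blast
  then show ?thesis
    using I_le by (meson order_trans)
qed

subsection \<open>Competitors\<close>

lemma N_alpha_cylinder:
  assumes "0 < \<alpha>"
  shows "N_alpha \<alpha> (\<lambda>x. \<alpha>) (\<lambda>x. 0) (\<lambda>x. 0)"
    and "helfrich_fun \<epsilon> (\<lambda>x. \<alpha>) (\<lambda>x. 0) (\<lambda>x. 0) = pi * (1 / \<alpha> + 4 * \<epsilon> * \<alpha>)"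
proof -
  show N: "N_alpha \<alpha> (\<lambda>x. \<alpha>) (\<lambda>x. 0) (\<lambda>x. 0)"
    using assms by (auto simp: N_alpha_def H2_triple_def set_integrable_def)
  show "helfrich_fun \<epsilon> (\<lambda>x. \<alpha>) (\<lambda>x. 0) (\<lambda>x. 0) = pi * (1 / \<alpha> + 4 * \<epsilon> * \<alpha>)"
    unfolding helfrich_fun_eq[OF N] using assms by (simp add: set_integral_const field_simps)
qed

lemma cylinder_below_threshold:
  fixes \<alpha> \<epsilon> :: real
  assumes "1 / 4 < \<alpha>" "0 \<le> \<epsilon>" "\<epsilon> < 1 / \<alpha>"
  shows "pi * (1 / \<alpha> + 4 * \<epsilon> * \<alpha>) < 4 * pi * sqrt (1 + \<epsilon>)"
proof -
  have \<alpha>: "0 < \<alpha>" using assms by simp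
  have "0 < 1 / \<alpha>" "1 / \<alpha> < 4" "0 \<le> 4 * \<epsilon> * \<alpha>" "4 * \<epsilon> * \<alpha> < 4"
    using assms \<alpha> by (simp_all add: field_simps)
  then have "\<bar>1 / \<alpha> - 4 * \<epsilon> * \<alpha>\<bar> < 4" by linarith
  then have "(1 / \<alpha> - 4 * \<epsilon> * \<alpha>)\<^sup>2 < 4\<^sup>2"
    by (metis abs_ge_zero power2_abs power_strict_mono zero_less_numeral)
  \<comment> \<open>The product of 1 / \<alpha> and 4 \<epsilon> \<alpha> does not depend on
    \<alpha>; passing from the square of the difference to that of the sum therefore adds exactly 16
    \<epsilon>.\<close>
  moreover have "(1 / \<alpha> + 4 * \<epsilon> * \<alpha>)\<^sup>2 = (1 / \<alpha> - 4 * \<epsilon> * \<alpha>)\<^sup>2 + 16 * \<epsilon>"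
    using \<alpha> by (simp add: power2_eq_square field_simps)
  ultimately have "(1 / \<alpha> + 4 * \<epsilon> * \<alpha>)\<^sup>2 < 16 * (1 + \<epsilon>)" by simp
  then have "1 / \<alpha> + 4 * \<epsilon> * \<alpha> < sqrt (16 * (1 + \<epsilon>))"
    by (rule real_less_rsqrt)
  then have "1 / \<alpha> + 4 * \<epsilon> * \<alpha> < 4 * sqrt (1 + \<epsilon>)"
    unfolding real_sqrt_mult by (simp add: real_sqrt_unique[of 4 16])
  then show ?thesis by simp
qed

text \<open>No one-sided derivatives are computed at the junctions: the fundamental theorem with
  finitely many exceptions writes \<open>f\<close> as an integral of the continuous
  \<open>f'\<close>, and differentiating that integral covers the exceptional points.\<close>

lemma has_derivative_of_finite_exceptions:
  fixes f f' :: "real \<Rightarrow> real"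
  assumes "finite S" "continuous_on {a..b} f" "continuous_on {a..b} f'"
    and D: "\<And>x. x \<in> {a<..<b} - S \<Longrightarrow> (f has_real_derivative f' x) (at x)"
    and x: "x \<in> {a..b}"
  shows "(f has_real_derivative f' x) (at x within {a..b})"
proof -
  have eq: "f a + integral {a..y} f' = f y" if "y \<in> {a..b}" for y
  proof -
    have "(f' has_integral (f y - f a)) {a..y}"
      using that assms
      by (intro fundamental_theorem_of_calculus_interior_strong[OF \<open>finite S\<close>])
         (auto simp: has_real_derivative_iff_has_vector_derivative[symmetric] intro: continuous_on_subset)
    then show ?thesis by (simp add: integral_unique)
  qed
  have "((\<lambda>y. f a + integral {a..y} f') has_real_derivative f' x) (at x within {a..b})"
    using integral_has_real_derivative[OF assms(3) x] by (auto intro!: derivative_eq_intros)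
  then show ?thesis
    by (rule has_field_derivative_transform_within[where d=1]) (use eq x in auto)
qed

text \<open>Meant for a second derivative that jumps where two curves are joined; the outer formula
  is used on the complement, which need not be an interval.\<close>

lemma set_integrable_two_pieces:
  fixes f g h :: "real \<Rightarrow> real"
  assumes g: "continuous_on {c..d} g" and h: "continuous_on {a..b} h"
    and eq: "\<And>x. x \<in> {c..d} \<Longrightarrow> f x = g x" "\<And>x. x \<in> {a..b} - {c..d} \<Longrightarrow> f x = h x"
    and sub: "{c..d} \<subseteq> {a..b}"
  shows "set_integrable lborel {a..b} f"
proof -
  have "set_integrable lborel {c..d} f"
    using set_integrable_continuous_Icc[OF g] by (subst set_integrable_cong[OF refl refl eq(1)])
  moreover have "set_integrable lborel ({a..b} - {c..d}) h"
    using set_integrable_continuous_Icc[OF h] by (rule set_integrable_subset) auto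
  then have "set_integrable lborel ({a..b} - {c..d}) f"
    by (subst set_integrable_cong[OF refl refl eq(2)])
  ultimately have "set_integrable lborel ({c..d} \<union> ({a..b} - {c..d})) f"
    by (intro set_integrable_Un) auto
  then show ?thesis using sub by (simp add: Un_absorb1)
qed

section \<open>Hyperbolic inequalities and the circle-catenary competitor\<close>

lemma nonneg_of_derivative_nonneg:
  fixes f f' :: "real \<Rightarrow> real"
  assumes "\<And>x. (f has_real_derivative f' x) (at x)" "\<And>x. 0 \<le> x \<Longrightarrow> 0 \<le> f' x" "f 0 = 0" "0 \<le> x"
  shows "0 \<le> f x"
  using DERIV_nonneg_imp_nondecreasing[of 0 x f] assms by metis

lemma sinh_ge_self: "x \<le> sinh x" if "0 \<le> x" for x :: real
proof -
  have "0 \<le> sinh x - x"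
    by (rule nonneg_of_derivative_nonneg[where f'="\<lambda>x. cosh x - 1"])
       (auto intro!: derivative_eq_intros that simp: cosh_real_ge_1)
  then show ?thesis by simp
qed

text \<open>At 1 / \<alpha> and after scaling, the cubic term becomes the 1 / (24 \<alpha>) that
  compensates, for small \<alpha>, the -1/4 in the denominator of the second hypothesis.\<close>

lemma sinh_ge_cubic: "x + x ^ 3 / 6 \<le> sinh x" if "0 \<le> x" for x :: real
proof -
  have cosh: "0 \<le> cosh y - 1 - y\<^sup>2 / 2" if "0 \<le> y" for y :: real
    by (rule nonneg_of_derivative_nonneg[where f="\<lambda>x. cosh x - 1 - x\<^sup>2 / 2" and f'="\<lambda>x. sinh x - x"])
       (auto intro!: derivative_eq_intros that simp: sinh_ge_self)
  have "0 \<le> sinh x - x - x ^ 3 / 6"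
    by (rule nonneg_of_derivative_nonneg[where f="\<lambda>x. sinh x - x - x ^ 3 / 6"
          and f'="\<lambda>x. cosh x - 1 - x\<^sup>2 / 2"])
       (auto intro!: derivative_eq_intros that dest: cosh)
  then show ?thesis by simp
qed

text \<open>The equation says that the half-width \<alpha> sinh t cosh t of the arc and the width
  \<alpha> t of one catenary add up to 1. The lower bound on t later limits the half-width to 1 -
  \<alpha>; the upper bound brings in the tanh of the hypothesis.\<close>

lemma circle_catenary_parameter:
  fixes \<alpha> :: real
  assumes "0 < \<alpha>" "\<alpha> \<le> 1 / 4"
  obtains t where "1 \<le> t" "t \<le> 1 / (2 * \<alpha>)" "\<alpha> * t + \<alpha> * sinh t * cosh t = 1"
proof -
  define F where "F t = \<alpha> * t + \<alpha> * sinh t * cosh t" for t :: real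
  \<comment> \<open>Here \<alpha> \<le> 1/4 enters: e \<le> 3 gives 1 + sinh 1 cosh 1 \<le>
    4.\<close>
  have F1: "F 1 \<le> 1"
  proof -
    have "sinh 1 \<le> (3 / 2 :: real)" "cosh 1 \<le> (2::real)"
      using exp_le exp_le_one_iff[of "-1::real"] exp_gt_zero[of "-1::real"]
      by (simp_all add: sinh_field_def cosh_field_def del: exp_le_one_iff exp_gt_zero)
    then have "sinh 1 * cosh 1 \<le> (3 / 2 * 2 :: real)"
      by (intro mult_mono) auto
    then have "1 + sinh 1 * cosh 1 \<le> (4::real)" by simp
    then have "\<alpha> * (1 + sinh 1 * cosh 1) \<le> 1 / 4 * 4"
      using assms by (intro mult_mono) auto
    then show ?thesis by (simp add: F_def algebra_simps)
  qed
  \<comment> \<open>Each of the two summands of \<open>F\<close> contributes at least 1/2 at this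
    point.\<close>
  have F2: "1 \<le> F (1 / (2 * \<alpha>))"
  proof -
    have "1 / (2 * \<alpha>) * 1 \<le> sinh (1 / (2 * \<alpha>)) * cosh (1 / (2 * \<alpha>))"
      using assms sinh_ge_self[of "1 / (2 * \<alpha>)"] cosh_real_ge_1 by (intro mult_mono) auto
    from mult_left_mono[OF this, of \<alpha>] show ?thesis
      using assms by (simp add: F_def)
  qed
  have "1 \<le> 1 / (2 * \<alpha>)"
    using assms by (simp add: field_simps)
  moreover have "continuous_on {1..1 / (2 * \<alpha>)} F"
    unfolding F_def by (intro continuous_intros)
  ultimately obtain t where "1 \<le> t" "t \<le> 1 / (2 * \<alpha>)" "F t = 1"
    using IVT'[of F 1 1 "1 / (2 * \<alpha>)"] F1 F2 by blast
  then show thesis using that by (simp add: F_def)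
qed

text \<open>The catenary \<alpha> cosh ((1 - |x|) / \<alpha>) meets the boundary data; at parameter
  t its height is \<alpha> cosh t and its slope has modulus sinh t. For a smooth junction its normal
  there must pass through the origin, which forces \<open>x\<^sub>1\<close> = height times slope and
  \<open>R\<close> = height times sqrt (1 + slope^2).\<close>

lemma circle_catenary_competitor:
  fixes \<alpha> t :: real
  assumes "0 < \<alpha>" "0 < t" and eq: "\<alpha> * t + \<alpha> * sinh t * cosh t = 1"
  defines "x\<^sub>1 \<equiv> \<alpha> * sinh t * cosh t" and "R \<equiv> \<alpha> * (cosh t)\<^sup>2"
  obtains w w1 w2 where "N_alpha \<alpha> w w1 w2"
    "helfrich_fun \<epsilon> w w1 w2 = 4 * pi * (tanh t + \<epsilon> * (R * x\<^sub>1 + \<alpha> / 2))"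
proof -
  \<comment> \<open>The catenary parameter measured from the end points: 0 at 1 and -1 and, by the
    equation for t, equal to t at the junctions.\<close>
  define s where "s x = (1 - \<bar>x\<bar>) / \<alpha>" for x
  define c where "c x = sqrt (R\<^sup>2 - x\<^sup>2)" for x
  define w where "w x = (if \<bar>x\<bar> \<le> x\<^sub>1 then c x else \<alpha> * cosh (s x))" for x
  \<comment> \<open>The quotient \<open>x / \<bar>x\<bar>\<close> is the sign of x; the point 0
    falls into the arc branch because \<open>x\<^sub>1\<close> is positive.\<close>
  define w1 where "w1 x = (if \<bar>x\<bar> \<le> x\<^sub>1 then - x / c x else - (x / \<bar>x\<bar>) * sinh (s x))" for x
  define w2 where "w2 x = (if \<bar>x\<bar> \<le> x\<^sub>1 then - R\<^sup>2 / c x ^ 3 else cosh (s x) / \<alpha>)" for x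
  have C: "0 < cosh t" "0 < sinh t" "(cosh t)\<^sup>2 = 1 + (sinh t)\<^sup>2"
    using \<open>0 < t\<close> by (auto simp: cosh_real_pos cosh_square_eq)
  have x1: "0 < x\<^sub>1" "1 - x\<^sub>1 = \<alpha> * t"
    using eq \<open>0 < \<alpha>\<close> C by (auto simp: x\<^sub>1_def)
  moreover have "0 < \<alpha> * t"
    using assms by simp
  ultimately have x1_less: "x\<^sub>1 < 1" by linarith
  have R: "0 < R"
    unfolding R_def using C(1) \<open>0 < \<alpha>\<close> by (intro mult_pos_pos zero_less_power)
  have Rx: "R\<^sup>2 - x\<^sub>1\<^sup>2 = (\<alpha> * cosh t)\<^sup>2"
    unfolding R_def x\<^sub>1_def using C(3) by algebra
  have s1: "s x = t" if "\<bar>x\<bar> = x\<^sub>1" for x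
    using x1 \<open>0 < \<alpha>\<close> that by (simp add: s_def)
  have csq: "0 < R\<^sup>2 - x\<^sup>2" if "\<bar>x\<bar> \<le> x\<^sub>1" for x
  proof -
    have "x\<^sup>2 \<le> x\<^sub>1\<^sup>2" using that by (metis abs_ge_zero power2_abs power_mono)
    moreover have "0 < (\<alpha> * cosh t)\<^sup>2"
      using C(1) \<open>0 < \<alpha>\<close> by (intro mult_pos_pos zero_less_power)
    ultimately show ?thesis using Rx by linarith
  qed
  have c: "0 < c x" "(c x)\<^sup>2 = R\<^sup>2 - x\<^sup>2" if "\<bar>x\<bar> \<le> x\<^sub>1" for x
    using csq[OF that] by (auto simp: c_def)
  have c1: "c x = \<alpha> * cosh t" if "\<bar>x\<bar> = x\<^sub>1" for x
  proof -
    have "c x = sqrt (R\<^sup>2 - x\<^sub>1\<^sup>2)" using that by (metis c_def power2_abs)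
    then show ?thesis using C(1) \<open>0 < \<alpha>\<close> unfolding Rx by simp
  qed
  have cs: "continuous_on X s" "continuous_on X c" for X
    unfolding s_def c_def using \<open>0 < \<alpha>\<close> by (auto intro!: continuous_intros)
  have cw: "continuous_on {-1..1} w"
    unfolding w_def by (intro continuous_on_cases_le) (auto intro!: continuous_intros cs simp: c1 s1)
  have cw1: "continuous_on {-1..1} w1"
    unfolding w1_def
  proof (intro continuous_on_cases_le)
    show "continuous_on {x \<in> {-1..1}. \<bar>x\<bar> \<le> x\<^sub>1} (\<lambda>x. - x / c x)"
      using c(1) by (intro continuous_intros cs) force
    show "continuous_on {x \<in> {-1..1}. x\<^sub>1 \<le> \<bar>x\<bar>} (\<lambda>x. - (x / \<bar>x\<bar>) * sinh (s x))"
      using x1 by (auto intro!: continuous_intros cs)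
    show "- x / c x = - (x / \<bar>x\<bar>) * sinh (s x)" if "\<bar>x\<bar> = x\<^sub>1" for x
    proof -
      have "x / c x = x / (\<alpha> * cosh t)" using c1[OF that] by simp
      also have "\<dots> = x / \<bar>x\<bar> * sinh t"
        using that x1(1) C \<open>0 < \<alpha>\<close> by (simp add: x\<^sub>1_def field_simps)
      finally show ?thesis using s1[OF that] by simp
    qed
  qed (auto intro!: continuous_intros)
  have Dw: "(w has_real_derivative w1 x) (at x)" "(w1 has_real_derivative w2 x) (at x)"
    if x: "x \<in> {-1<..<1} - {-x\<^sub>1, x\<^sub>1}" for x
  proof -
    consider "\<bar>x\<bar> < x\<^sub>1" | "x\<^sub>1 < x" | "x < -x\<^sub>1"
      using x by force
    then have "(w has_real_derivative w1 x) (at x) \<and> (w1 has_real_derivative w2 x) (at x)"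
    proof cases
      case 1
      then have cx: "0 < c x" "(c x)\<^sup>2 = R\<^sup>2 - x\<^sup>2" "0 < R\<^sup>2 - x\<^sup>2"
        using c[of x] csq[of x] by auto
      have Dc: "(c has_real_derivative - x / c x) (at x)"
        unfolding c_def using cx(3) by (auto intro!: derivative_eq_intros simp: field_simps)
      have "((\<lambda>x. - x / c x) has_real_derivative (- 1 * c x - - x * (- x / c x)) / (c x * c x)) (at x)"
        using cx(1) by (intro DERIV_divide DERIV_minus DERIV_ident Dc) auto
      moreover have "(- 1 * c x - - x * (- x / c x)) / (c x * c x) = - R\<^sup>2 / c x ^ 3"
      proof -
        have "- 1 * c x - - x * (- x / c x) = - ((c x)\<^sup>2 + x\<^sup>2) / c x"
          using cx(1) by (simp add: field_simps power2_eq_square)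
        then show ?thesis
          using cx(1) by (simp add: cx(2) power3_eq_cube)
      qed
      ultimately have Dc2: "((\<lambda>x. - x / c x) has_real_derivative - R\<^sup>2 / c x ^ 3) (at x)"
        by simp
      have "(w has_real_derivative - x / c x) (at x)"
        by (rule has_field_derivative_transform_within_open[OF Dc, of "{-x\<^sub>1<..<x\<^sub>1}"])
           (use 1 in \<open>auto simp: w_def abs_le_iff\<close>)
      moreover have "(w1 has_real_derivative - R\<^sup>2 / c x ^ 3) (at x)"
        by (rule has_field_derivative_transform_within_open[OF Dc2, of "{-x\<^sub>1<..<x\<^sub>1}"])
           (use 1 in \<open>auto simp: w1_def abs_le_iff\<close>)
      ultimately show ?thesis
        using 1 by (simp add: w1_def w2_def)
    next
      case 2
      have D1: "((\<lambda>y. \<alpha> * cosh ((1 - y) / \<alpha>)) has_real_derivative - sinh ((1 - x) / \<alpha>)) (at x)"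
        and D2: "((\<lambda>y. - sinh ((1 - y) / \<alpha>)) has_real_derivative cosh ((1 - x) / \<alpha>) / \<alpha>) (at x)"
        using \<open>0 < \<alpha>\<close> by (auto intro!: derivative_eq_intros simp: field_simps)
      have "(w has_real_derivative - sinh ((1 - x) / \<alpha>)) (at x)"
        by (rule has_field_derivative_transform_within_open[OF D1, of "{x\<^sub>1<..}"])
           (use 2 x1(1) in \<open>auto simp: w_def s_def\<close>)
      moreover have "(w1 has_real_derivative cosh ((1 - x) / \<alpha>) / \<alpha>) (at x)"
        by (rule has_field_derivative_transform_within_open[OF D2, of "{x\<^sub>1<..}"])
           (use 2 x1(1) in \<open>auto simp: w1_def s_def\<close>)
      ultimately show ?thesis
        using 2 x1(1) by (simp add: w1_def w2_def s_def)
    next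
      case 3
      have D1: "((\<lambda>y. \<alpha> * cosh ((1 + y) / \<alpha>)) has_real_derivative sinh ((1 + x) / \<alpha>)) (at x)"
        and D2: "((\<lambda>y. sinh ((1 + y) / \<alpha>)) has_real_derivative cosh ((1 + x) / \<alpha>) / \<alpha>) (at x)"
        using \<open>0 < \<alpha>\<close> by (auto intro!: derivative_eq_intros simp: field_simps)
      have "(w has_real_derivative sinh ((1 + x) / \<alpha>)) (at x)"
        by (rule has_field_derivative_transform_within_open[OF D1, of "{..<-x\<^sub>1}"])
           (use 3 x1(1) in \<open>auto simp: w_def s_def\<close>)
      moreover have "(w1 has_real_derivative cosh ((1 + x) / \<alpha>) / \<alpha>) (at x)"
        by (rule has_field_derivative_transform_within_open[OF D2, of "{..<-x\<^sub>1}"])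
           (use 3 x1(1) in \<open>auto simp: w1_def s_def\<close>)
      ultimately show ?thesis
        using 3 x1(1) by (simp add: w1_def w2_def s_def)
    qed
    then show "(w has_real_derivative w1 x) (at x)" "(w1 has_real_derivative w2 x) (at x)"
      by auto
  qed
  have Dw': "(w has_real_derivative w1 x) (at x within {-1..1})" if "x \<in> {-1..1}" for x
    by (rule has_derivative_of_finite_exceptions[of "{-x\<^sub>1, x\<^sub>1}", OF _ cw cw1 Dw(1) that]) auto
  have sub: "{-x\<^sub>1..x\<^sub>1} \<subseteq> {-1..1}" using x1 x1_less by auto
  have c_nz: "c x \<noteq> 0" if "x \<in> {-x\<^sub>1..x\<^sub>1}" for x
    using c(1)[of x] that by (simp add: abs_le_iff)
  have i2: "set_integrable lborel {-1..1} w2"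
    using c_nz by (intro set_integrable_two_pieces[OF _ _ _ _ sub, of "\<lambda>x. - R\<^sup>2 / c x ^ 3" "\<lambda>x. cosh (s x) / \<alpha>"]
      continuous_intros cs) (auto simp: w2_def \<open>0 < \<alpha>\<close>[THEN less_imp_neq, symmetric])
  have i22: "set_integrable lborel {-1..1} (\<lambda>x. (w2 x)\<^sup>2)"
    using c_nz by (intro set_integrable_two_pieces[OF _ _ _ _ sub, of "\<lambda>x. (- R\<^sup>2 / c x ^ 3)\<^sup>2" "\<lambda>x. (cosh (s x) / \<alpha>)\<^sup>2"]
      continuous_intros cs) (auto simp: w2_def \<open>0 < \<alpha>\<close>[THEN less_imp_neq, symmetric])
  have w1_int: "w1 x = w1 (-1) + (\<integral>t\<in>{-1..x}. w2 t \<partial>lborel)" if x: "x \<in> {-1..1}" for x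
  proof -
    have "set_integrable lborel {-1..x} w2"
      using i2 x by (auto intro: set_integrable_subset)
    moreover have "(w2 has_integral (w1 x - w1 (-1))) {-1..x}"
      using x Dw(2) cw1
      by (intro fundamental_theorem_of_calculus_interior_strong[of "{-x\<^sub>1, x\<^sub>1}"])
         (auto simp: has_real_derivative_iff_has_vector_derivative[symmetric] intro: continuous_on_subset)
    ultimately show ?thesis
      by (simp add: set_borel_integral_eq_integral(2) integral_unique)
  qed
  have H2: "H2_triple w w1 w2"
    unfolding H2_triple_def using Dw' i2 i22 w1_int by blast
  have N: "N_alpha \<alpha> w w1 w2"
    unfolding N_alpha_def
  proof (intro conjI H2 ballI)
    show "w (-x) = w x" for x by (simp add: w_def c_def s_def)
    show "0 < w x" for x using c(1)[of x] \<open>0 < \<alpha>\<close> by (simp add: w_def cosh_real_pos)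
  qed (use x1_less in \<open>auto simp: w_def w1_def s_def\<close>)
  have root: "sqrt (1 + (w1 x)\<^sup>2) = (if \<bar>x\<bar> \<le> x\<^sub>1 then R / c x else cosh (s x))" for x
  proof (cases "\<bar>x\<bar> \<le> x\<^sub>1")
    case True
    then have "1 + (w1 x)\<^sup>2 = (R / c x)\<^sup>2"
      using c[OF True] csq[OF True] by (simp add: w1_def power_divide field_simps)
    then show ?thesis using True R c(1)[OF True] by simp
  next
    case False
    then have "1 + (w1 x)\<^sup>2 = (cosh (s x))\<^sup>2"
      using x1 by (simp add: w1_def power_mult_distrib power_divide cosh_square_eq)
    then show ?thesis using False by (simp add: cosh_real_nonneg)
  qed
  have willmore: "willmore_fun w w1 w2 = 4 * pi * tanh t"
  proof -
    \<comment> \<open>On the arc the two curvature terms both equal 1 / R and add up, while u J = R,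
      so the density is 4 / R; on the catenaries they cancel.\<close>
    have "(1 / (w x * sqrt (1 + (w1 x)\<^sup>2)) - w2 x / sqrt (1 + (w1 x)\<^sup>2) ^ 3)\<^sup>2 * w x * sqrt (1 + (w1 x)\<^sup>2)
        = indicator {-x\<^sub>1..x\<^sub>1} x * (4 / R)" for x
    proof (cases "\<bar>x\<bar> \<le> x\<^sub>1")
      case True
      have "1 / (c x * (R / c x)) - - R\<^sup>2 / c x ^ 3 / (R / c x) ^ 3 = 2 / R"
        using c(1)[OF True] R by (simp add: power_divide eval_nat_numeral)
      moreover have "(2 / R)\<^sup>2 * c x * (R / c x) = 4 / R"
        using c(1)[OF True] R by (simp add: power2_eq_square)
      ultimately show ?thesis
        using True by (simp add: root w_def w2_def abs_le_iff)
    next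
      case False
      have "cosh (s x) \<noteq> 0" by simp
      then have "1 / (\<alpha> * cosh (s x) * cosh (s x)) - cosh (s x) / \<alpha> / cosh (s x) ^ 3 = 0"
        by (simp add: eval_nat_numeral)
      then show ?thesis
        using False by (auto simp: root w_def w2_def abs_le_iff)
    qed
    then have "willmore_fun w w1 w2 = pi / 2 * (\<integral>x\<in>{-1..1}. indicator {-x\<^sub>1..x\<^sub>1} x * (4 / R) \<partial>lborel)"
      unfolding willmore_fun_def by simp
    also have "(\<integral>x\<in>{-1..1}. indicator {-x\<^sub>1..x\<^sub>1} x * (4 / R) \<partial>lborel) = (\<integral>x\<in>{-x\<^sub>1..x\<^sub>1}. 4 / R \<partial>lborel)"
      unfolding set_lebesgue_integral_def using sub
      by (intro Bochner_Integration.integral_cong) (auto simp: indicator_def)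
    also have "\<dots> = 8 * (x\<^sub>1 / R)"
      using x1 by (simp add: set_integral_const)
    also have "x\<^sub>1 / R = tanh t"
      using C(1) \<open>0 < \<alpha>\<close> by (simp add: x\<^sub>1_def R_def tanh_def power2_eq_square)
    finally show ?thesis by simp
  qed
  have area: "area_fun w w1 = 4 * pi * (R * x\<^sub>1 + \<alpha> / 2)"
  proof -
    define y where "y x = w x * sqrt (1 + (w1 x)\<^sup>2)" for x
    have int_y: "set_integrable lborel {-1..1} y"
      unfolding y_def by (rule N_alpha_integrable(3)[OF N])
    \<comment> \<open>Archimedes: the area of a sphere per unit length of its axis is
      constant.\<close>
    have y_in: "y x = R" if "\<bar>x\<bar> \<le> x\<^sub>1" for x
      unfolding y_def root using c(1)[OF that] that by (simp add: w_def)
    have y_out: "y x = \<alpha> * (cosh (s x))\<^sup>2" if "x\<^sub>1 \<le> \<bar>x\<bar>" for x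
    proof (cases "\<bar>x\<bar> = x\<^sub>1")
      case True
      then show ?thesis using y_in[of x] s1[OF True] by (simp add: R_def)
    next
      case False
      then show ?thesis
        unfolding y_def root using that by (simp add: w_def power2_eq_square)
    qed
    \<comment> \<open>A primitive of \<alpha>^2 cosh^2; the equation for t reappears in its value at
      t, hence the plain \<alpha> / 2 for each catenary.\<close>
    define F where "F z = \<alpha>\<^sup>2 / 2 * (z + sinh z * cosh z)" for z
    have DF: "(F has_real_derivative \<alpha>\<^sup>2 * (cosh z)\<^sup>2) (at z)" for z
    proof -
      have "(F has_real_derivative \<alpha>\<^sup>2 / 2 * (1 + (cosh z * cosh z + sinh z * sinh z))) (at z)"
        unfolding F_def by (auto intro!: derivative_eq_intros)
      moreover have "\<alpha>\<^sup>2 / 2 * (1 + (cosh z * cosh z + sinh z * sinh z)) = \<alpha>\<^sup>2 * (cosh z)\<^sup>2"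
        using cosh_square_eq[of z] by (simp add: power2_eq_square algebra_simps)
      ultimately show ?thesis by (simp only:)
    qed
    have F: "F 0 = 0" "F t = \<alpha> / 2"
    proof -
      have "F t = \<alpha> / 2 * (\<alpha> * t + \<alpha> * sinh t * cosh t)"
        by (simp add: F_def power2_eq_square algebra_simps)
      then show "F t = \<alpha> / 2" unfolding eq by simp
    qed (simp add: F_def)
    have right: "(y has_integral (\<alpha> / 2)) {x\<^sub>1..1}"
    proof -
      have "((\<lambda>x. \<alpha> * (cosh ((1 - x) / \<alpha>))\<^sup>2) has_integral (- F ((1 - 1) / \<alpha>) - - F ((1 - x\<^sub>1) / \<alpha>))) {x\<^sub>1..1}"
      proof (rule fundamental_theorem_of_calculus)
        fix x
        have "((\<lambda>x. - F ((1 - x) / \<alpha>)) has_real_derivative - (\<alpha>\<^sup>2 * (cosh ((1 - x) / \<alpha>))\<^sup>2 * (- 1 / \<alpha>))) (at x)"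
          using \<open>0 < \<alpha>\<close> by (intro DERIV_minus DERIV_chain2[OF DF]) (auto intro!: derivative_eq_intros)
        then have "((\<lambda>x. - F ((1 - x) / \<alpha>)) has_real_derivative \<alpha> * (cosh ((1 - x) / \<alpha>))\<^sup>2) (at x)"
          using \<open>0 < \<alpha>\<close> by (simp add: power2_eq_square[of \<alpha>])
        then show "((\<lambda>x. - F ((1 - x) / \<alpha>)) has_vector_derivative \<alpha> * (cosh ((1 - x) / \<alpha>))\<^sup>2) (at x within {x\<^sub>1..1})"
          by (simp add: has_real_derivative_iff_has_vector_derivative has_vector_derivative_at_within)
      qed (use x1_less in simp)
      moreover have "- F ((1 - 1) / \<alpha>) - - F ((1 - x\<^sub>1) / \<alpha>) = \<alpha> / 2"
        using F x1(2) \<open>0 < \<alpha>\<close> by simp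
      ultimately have "((\<lambda>x. \<alpha> * (cosh ((1 - x) / \<alpha>))\<^sup>2) has_integral \<alpha> / 2) {x\<^sub>1..1}"
        by (simp only:)
      then show ?thesis
        using x1(1) by (subst has_integral_cong[where g="\<lambda>x. \<alpha> * (cosh ((1 - x) / \<alpha>))\<^sup>2"])
          (simp_all add: y_out s_def)
    qed
    have y_even: "y (- x) = y x" for x
      unfolding y_def root by (simp add: w_def c_def s_def)
    have left: "(y has_integral (\<alpha> / 2)) {-1..-x\<^sub>1}"
      using has_integral_reflect_real[of y "\<alpha> / 2" 1 "x\<^sub>1"] right by (simp add: y_even)
    have mid: "(y has_integral (R * (2 * x\<^sub>1))) {-x\<^sub>1..x\<^sub>1}"
    proof -
      have "((\<lambda>x. R) has_integral (R * (2 * x\<^sub>1))) {-x\<^sub>1..x\<^sub>1}"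
        using has_integral_const_real[of R "-x\<^sub>1" "x\<^sub>1"] x1 by (simp add: mult.commute)
      then show ?thesis
        by (subst has_integral_cong[where g="\<lambda>x. R"]) (auto simp: y_in abs_le_iff)
    qed
    have "(y has_integral (\<alpha> / 2 + R * (2 * x\<^sub>1) + \<alpha> / 2)) {-1..1}"
      using x1 x1_less by (intro has_integral_combine[OF _ _ has_integral_combine[OF _ _ left mid] right]) auto
    then have "(\<integral>x\<in>{-1..1}. y x \<partial>lborel) = \<alpha> + 2 * R * x\<^sub>1"
      using set_borel_integral_eq_integral(2)[OF int_y] by (simp add: integral_unique)
    then show ?thesis
      by (simp add: area_fun_def y_def algebra_simps)
  qed
  show thesis
    using that[OF N] willmore area by (simp add: helfrich_fun_def algebra_simps)
qed

text \<open>These are the estimates through which the denominator of the second hypothesis enters.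
  The first compares it with the cylinder condition, the second with an upper bound for the area
  term R \<open>x\<^sub>1\<close> + \<alpha> / 2 of the competitor.\<close>

lemma area_constant_ge:
  fixes \<alpha> :: real
  assumes "0 < \<alpha>"
  shows "\<alpha> < sqrt (1 + \<alpha>\<^sup>2) + \<alpha>/4 + \<alpha>\<^sup>2/4 * sinh (1/\<alpha>) - 1/4"
    and "1 - \<alpha> + \<alpha>/2 \<le> sqrt (1 + \<alpha>\<^sup>2) + \<alpha>/4 + \<alpha>\<^sup>2/4 * sinh (1/\<alpha>) - 1/4"
proof -
  \<comment> \<open>Combined with weights 1/4 and 3/4, these two bounds give a root of at least 1/4
    + 3 \<alpha> / 4, which already absorbs the -1/4 in the first claim.\<close>
  have sq: "1 \<le> sqrt (1 + \<alpha>\<^sup>2)" "\<alpha> \<le> sqrt (1 + \<alpha>\<^sup>2)"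
    by (auto intro: real_le_rsqrt)
  have "\<alpha>\<^sup>2/4 * (1/\<alpha> + (1/\<alpha>) ^ 3 / 6) \<le> \<alpha>\<^sup>2/4 * sinh (1/\<alpha>)"
    using assms by (intro mult_left_mono sinh_ge_cubic) auto
  moreover have "\<alpha>\<^sup>2/4 * (1/\<alpha> + (1/\<alpha>) ^ 3 / 6) = \<alpha>/4 + 1/(24*\<alpha>)"
    using assms by (simp add: field_simps eval_nat_numeral)
  ultimately have sh: "\<alpha>/4 + 1/(24*\<alpha>) \<le> \<alpha>\<^sup>2/4 * sinh (1/\<alpha>)"
    by simp
  moreover have "0 < 1/(24*\<alpha>)"
    using assms by simp
  ultimately show "\<alpha> < sqrt (1 + \<alpha>\<^sup>2) + \<alpha>/4 + \<alpha>\<^sup>2/4 * sinh (1/\<alpha>) - 1/4"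
    using sq by linarith
  \<comment> \<open>The quadratic 24 \<alpha>^2 - 6 \<alpha> + 1 has no real root; the square used
    is centred at its vertex 1/8.\<close>
  have "1/4 \<le> \<alpha> + 1/(24*\<alpha>)"
  proof -
    have "0 \<le> (24 * \<alpha> - 3)\<^sup>2" by simp
    then have "6 * \<alpha> \<le> 24 * \<alpha>\<^sup>2 + 1"
      by (simp add: power2_eq_square algebra_simps)
    then show ?thesis
      using assms by (simp add: field_simps power2_eq_square)
  qed
  then show "1 - \<alpha> + \<alpha>/2 \<le> sqrt (1 + \<alpha>\<^sup>2) + \<alpha>/4 + \<alpha>\<^sup>2/4 * sinh (1/\<alpha>) - 1/4"
    using sh sq by linarith
qed

lemma circle_catenary_below_threshold:
  fixes \<alpha> \<epsilon> :: real
  assumes "0 < \<alpha>" "\<alpha> \<le> 1/4" "0 \<le> \<epsilon>"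
    and \<epsilon>: "\<epsilon> \<le> (1 - tanh (1 / (2*\<alpha>))) /
               (sqrt (1 + \<alpha>\<^sup>2) + \<alpha>/4 + \<alpha>\<^sup>2/4 * sinh (1/\<alpha>) - 1/4)"
  obtains w w1 w2 where "N_alpha \<alpha> w w1 w2" "helfrich_fun \<epsilon> w w1 w2 < 4 * pi * sqrt (1 + \<epsilon>)"
proof -
  define D where "D = sqrt (1 + \<alpha>\<^sup>2) + \<alpha>/4 + \<alpha>\<^sup>2/4 * sinh (1/\<alpha>) - 1/4"
  have D: "0 < D"
    using area_constant_ge(1)[OF \<open>0 < \<alpha>\<close>] assms unfolding D_def by linarith
  obtain t where t: "1 \<le> t" "t \<le> 1 / (2 * \<alpha>)" "\<alpha> * t + \<alpha> * sinh t * cosh t = 1"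
    by (rule circle_catenary_parameter[OF assms(1,2)])
  define x\<^sub>1 where "x\<^sub>1 = \<alpha> * sinh t * cosh t"
  define R where "R = \<alpha> * (cosh t)\<^sup>2"
  obtain w w1 w2 where N: "N_alpha \<alpha> w w1 w2"
    and H: "helfrich_fun \<epsilon> w w1 w2 = 4 * pi * (tanh t + \<epsilon> * (R * x\<^sub>1 + \<alpha> / 2))"
    unfolding R_def x\<^sub>1_def by (rule circle_catenary_competitor[OF \<open>0 < \<alpha>\<close> _ t(3)]) (use t in auto)
  have "\<alpha> * 1 \<le> \<alpha> * t"
    using assms t by (intro mult_left_mono) auto
  then have x1: "x\<^sub>1 \<le> 1 - \<alpha>"
    using t(3) unfolding x\<^sub>1_def by linarith
  have x1_nonneg: "0 \<le> x\<^sub>1"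
    using t(1) \<open>0 < \<alpha>\<close> by (simp add: x\<^sub>1_def)
  have "R - x\<^sub>1 = \<alpha> * (cosh t * exp (- t))"
    by (simp add: R_def x\<^sub>1_def power2_eq_square algebra_simps flip: cosh_minus_sinh)
  moreover have "cosh t * exp (- t) \<le> 1"
  proof -
    have "cosh t * exp (- t) = (1 + exp (- t) * exp (- t)) / 2"
      by (simp add: cosh_field_def distrib_right exp_minus)
    moreover have "exp (- t) * exp (- t) \<le> 1 * 1"
      using t by (intro mult_mono) auto
    ultimately show ?thesis by simp
  qed
  ultimately have "R - x\<^sub>1 \<le> \<alpha>"
    using assms by simp
  then have "R * x\<^sub>1 \<le> 1 * x\<^sub>1"
    using x1 x1_nonneg by (intro mult_right_mono) auto
  then have area: "R * x\<^sub>1 + \<alpha>/2 \<le> D"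
    using x1 area_constant_ge(2)[OF \<open>0 < \<alpha>\<close>] unfolding D_def by linarith
  have "tanh t + \<epsilon> * (R * x\<^sub>1 + \<alpha> / 2) < sqrt (1 + \<epsilon>)"
  proof (cases "\<epsilon> = 0")
    case True
    then show ?thesis by (simp add: tanh_real_lt_1)
  next
    case False
    have "\<epsilon> * (R * x\<^sub>1 + \<alpha> / 2) \<le> \<epsilon> * D"
      using area \<open>0 \<le> \<epsilon>\<close> by (rule mult_left_mono)
    moreover have "\<epsilon> * D \<le> 1 - tanh (1 / (2 * \<alpha>))"
      using \<epsilon> D unfolding D_def[symmetric] by (simp add: le_divide_eq)
    moreover have "tanh t \<le> tanh (1 / (2 * \<alpha>))"
      using t by simp
    moreover have "1 < sqrt (1 + \<epsilon>)"
      using False \<open>0 \<le> \<epsilon>\<close> by simp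
    ultimately show ?thesis by linarith
  qed
  then show thesis
    using that[OF N] H by simp
qed

theorem theorem3p4:
  fixes \<alpha> \<epsilon> :: real
  assumes "\<alpha> > 0" and "\<epsilon> \<ge> 0"
    and "(\<alpha> > 1/4 \<and> \<epsilon> < 1/\<alpha>) \<or>
         \<epsilon> \<le> (1 - tanh (1 / (2*\<alpha>))) /
               (sqrt (1 + \<alpha>\<^sup>2) + \<alpha>/4 + \<alpha>\<^sup>2/4 * sinh (1/\<alpha>) - 1/4)"
  shows "\<exists>u u1 u2. N_alpha \<alpha> u u1 u2 \<and>
           (\<forall>v v1 v2. N_alpha \<alpha> v v1 v2 \<longrightarrow> helfrich_fun \<epsilon> u u1 u2 \<le> helfrich_fun \<epsilon> v v1 v2)"
proof (cases "\<alpha> \<le> 1/4")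
  case True
  then have small: "\<epsilon> \<le> (1 - tanh (1 / (2*\<alpha>))) /
      (sqrt (1 + \<alpha>\<^sup>2) + \<alpha>/4 + \<alpha>\<^sup>2/4 * sinh (1/\<alpha>) - 1/4)"
    using assms(3) by (meson leD)
  obtain w w1 w2 where "N_alpha \<alpha> w w1 w2" "helfrich_fun \<epsilon> w w1 w2 < 4 * pi * sqrt (1 + \<epsilon>)"
    by (rule circle_catenary_below_threshold[OF \<open>\<alpha> > 0\<close> True \<open>\<epsilon> \<ge> 0\<close> small])
  then show ?thesis
    by (rule helfrich_minimiser_exists[OF assms(1,2)])
next
  case False
  define D where "D = sqrt (1 + \<alpha>\<^sup>2) + \<alpha>/4 + \<alpha>\<^sup>2/4 * sinh (1/\<alpha>) - 1/4"
  \<comment> \<open>For \<open>\<alpha> > 1/4\<close> the second hypothesis is stronger than the first one.\<close>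
  have "(1 - tanh (1 / (2*\<alpha>))) / D < 1 / \<alpha>"
  proof -
    have D: "\<alpha> < D"
      unfolding D_def by (rule area_constant_ge(1)[OF \<open>\<alpha> > 0\<close>])
    have "0 < tanh (1 / (2*\<alpha>))"
      using \<open>\<alpha> > 0\<close> by simp
    then have "(1 - tanh (1 / (2*\<alpha>))) / D \<le> 1 / D"
      using D \<open>\<alpha> > 0\<close> by (intro divide_right_mono) auto
    also have "\<dots> < 1 / \<alpha>"
      using D \<open>\<alpha> > 0\<close> by (intro divide_strict_left_mono) auto
    finally show ?thesis .
  qed
  then have "\<epsilon> < 1 / \<alpha>"
    using assms(3) unfolding D_def by linarith
  then have "helfrich_fun \<epsilon> (\<lambda>x. \<alpha>) (\<lambda>x. 0) (\<lambda>x. 0) < 4 * pi * sqrt (1 + \<epsilon>)"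
    unfolding N_alpha_cylinder(2)[OF \<open>\<alpha> > 0\<close>] using False assms(2)
    by (intro cylinder_below_threshold) auto
  then show ?thesis
    by (rule helfrich_minimiser_exists[OF assms(1,2) N_alpha_cylinder(1)[OF \<open>\<alpha> > 0\<close>]])
qed

end
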